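(* Let $n\ge 2$, $u_-\le 0$ and $u_+=0$. For any $\rho_+>0$ there exist positive constants $\epsilon_0$ and $C$, independent of $\mu\in(0,1]$ (and of $u_-$), such that the following hold. (I) If $|u_-|\le\epsilon_0$, there exists a unique smooth solution $(\rho^E,u^E)$ of the stationary Euler problem (E) described in the context, with boundary condition $u^E(r_0)=u_-$, and it satisfies $$|\rho^E(r)-\rho_+|\le C r^{-2(n-1)}|u_-|^2,\qquad C^{-1}r^{-(n-1)}|u_-|\le |u^E(r)|\le C r^{-(n-1)}|u_-|,\qquad r\ge r_0.$$ (II) If $|u_-|\le\epsilon_0$, then for $\mu\in(0,1]$ the solution $(\rho,u)$ of the stationary Navier-Stokes problem (NS) described in the context converges uniformly to $(\rho^E,u^E)$ as $\mu\to0$; more precisely $$\sup_{r\ge r_0}|(\rho-\rho^E,\,u-u^E)(r)|\le C\mu .$$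
   Context: Fix $r_0>0$, an integer $n\ge2$, and a smooth pressure function $p=p(\rho)$ on $\rho>0$ with $p'(\rho)>0$ for all $\rho>0$. Densities are positive. $\mu>0$ is a viscosity constant. Constants may depend on $n,r_0,p,\rho_+$. Problem (NS) (radially symmetric stationary barotropic Navier-Stokes, outflow/impermeable wall case $u_-\le0$, with $u_+=0$): find $(\rho,u)(r)$, $\rho>0$, with $$(r^{n-1}\rho u)_r=0,\qquad \rho u u_r+p(\rho)_r=\mu\Big(\frac{(r^{n-1}u)_r}{r^{n-1}}\Big)_r,\quad r>r_0,$$ $$\lim_{r\to\infty}(\rho,u)(r)=(\rho_+,0),\qquad u(r_0)=u_-.$$ Known fact (earlier work): for each $\rho_+>0$ there are positive constants, which can be taken uniform in $\mu\in(0,1]$, such that for $|u_-|$ sufficiently small (NS) has a unique smooth solution $(\rho,u)$ satisfying $|\rho(r)-\rho_+|\le Cr^{-2(n-1)}|u_-|^2$ and $C^{-1}r^{-(n-1)}|u_-|\le|u(r)|\le Cr^{-(n-1)}|u_-|$ for $r\ge r_0$. "The solution $(\rho,u)$ of (NS)" means this solution. Problem (E) (stationary Euler): find $(\rho^E,u^E)(r)$, $\rho^E>0$, with $$(r^{n-1}\rho^Eu^E)_r=0,\qquad \rho^Eu^Eu^E_r+p(\rho^E)_r=0,\quad r>r_0,\qquad \lim_{r\to\infty}(\rho^E,u^E)(r)=(\rho_+,0).$$ *)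

theory Defs
  imports "HOL-Analysis.Analysis"
begin

text \<open>
  \<open>C\<^sup>\<infinity>\<close> functions on a set without isolated points. Derivatives are taken within
  \<open>S\<close>, so on \<open>{r0..}\<close> all derivatives exist (one-sidedly) up to the boundary point.
\<close>

definition smooth_on :: "real set \<Rightarrow> (real \<Rightarrow> real) \<Rightarrow> bool" where
  "smooth_on S f \<longleftrightarrow>
     (\<exists>D :: nat \<Rightarrow> real \<Rightarrow> real. (\<forall>x\<in>S. D 0 x = f x) \<and>
        (\<forall>k. \<forall>x\<in>S. (D k has_real_derivative D (Suc k) x) (at x within S)))"

text \<open>
  The parameters are the dimension \<open>n\<close>, the inner radius \<open>r0\<close>, the pressure \<open>p\<close>, the far-field
  density \<open>rp\<close> and the boundary velocity \<open>um\<close>. Only the values of \<open>\<rho>\<close> and \<open>u\<close> on \<open>{r0..}\<close>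
  are meaningful.
\<close>

definition far_field_and_boundary ::
  "real \<Rightarrow> real \<Rightarrow> real \<Rightarrow> (real \<Rightarrow> real) \<Rightarrow> (real \<Rightarrow> real) \<Rightarrow> bool" where
  "far_field_and_boundary r0 rp um \<rho> u \<longleftrightarrow>
     ((\<lambda>r. (\<rho> r, u r)) \<longlongrightarrow> (rp, 0)) at_top \<and> u r0 = um"

definition euler_solution ::
  "nat \<Rightarrow> real \<Rightarrow> (real \<Rightarrow> real) \<Rightarrow> real \<Rightarrow> real \<Rightarrow> (real \<Rightarrow> real) \<Rightarrow> (real \<Rightarrow> real) \<Rightarrow> bool" where
  "euler_solution n r0 p rp um \<rho> u \<longleftrightarrow>
     smooth_on {r0..} \<rho> \<and> smooth_on {r0..} u \<and> (\<forall>r\<ge>r0. \<rho> r > 0) \<and>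
     (\<forall>r>r0. deriv (\<lambda>s. s ^ (n - 1) * \<rho> s * u s) r = 0) \<and>
     (\<forall>r>r0. \<rho> r * u r * deriv u r + deriv (\<lambda>s. p (\<rho> s)) r = 0) \<and>
     far_field_and_boundary r0 rp um \<rho> u"

definition navier_stokes_solution ::
  "nat \<Rightarrow> real \<Rightarrow> (real \<Rightarrow> real) \<Rightarrow> real \<Rightarrow> real \<Rightarrow> real \<Rightarrow> (real \<Rightarrow> real) \<Rightarrow> (real \<Rightarrow> real) \<Rightarrow> bool" where
  "navier_stokes_solution n r0 p rp um \<mu> \<rho> u \<longleftrightarrow>
     smooth_on {r0..} \<rho> \<and> smooth_on {r0..} u \<and> (\<forall>r\<ge>r0. \<rho> r > 0) \<and>
     (\<forall>r>r0. deriv (\<lambda>s. s ^ (n - 1) * \<rho> s * u s) r = 0) \<and>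
     (\<forall>r>r0. \<rho> r * u r * deriv u r + deriv (\<lambda>s. p (\<rho> s)) r =
        \<mu> * deriv (\<lambda>s. deriv (\<lambda>t. t ^ (n - 1) * u t) s / s ^ (n - 1)) r) \<and>
     far_field_and_boundary r0 rp um \<rho> u"

definition decay_estimates ::
  "nat \<Rightarrow> real \<Rightarrow> real \<Rightarrow> real \<Rightarrow> real \<Rightarrow> (real \<Rightarrow> real) \<Rightarrow> (real \<Rightarrow> real) \<Rightarrow> bool" where
  "decay_estimates n r0 rp um C \<rho> u \<longleftrightarrow>
     (\<forall>r\<ge>r0. \<bar>\<rho> r - rp\<bar> \<le> C * inverse (r ^ (2 * (n - 1))) * \<bar>um\<bar>\<^sup>2 \<and>
        inverse C * inverse (r ^ (n - 1)) * \<bar>um\<bar> \<le> \<bar>u r\<bar> \<and>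
        \<bar>u r\<bar> \<le> C * inverse (r ^ (n - 1)) * \<bar>um\<bar>)"

text \<open>
  For small \<open>um\<close>, the Navier--Stokes problem is known to have a unique smooth solution obeying
  the decay estimates with a constant \<open>K\<close> independent of \<open>\<mu>\<close> and \<open>um\<close>; ``the'' solution of the
  Navier--Stokes problem is that one. The predicate below singles it out relative to \<open>K\<close>.
\<close>

definition decaying_navier_stokes_solution ::
  "nat \<Rightarrow> real \<Rightarrow> (real \<Rightarrow> real) \<Rightarrow> real \<Rightarrow> real \<Rightarrow> real \<Rightarrow> real \<Rightarrow> (real \<Rightarrow> real) \<Rightarrow> (real \<Rightarrow> real) \<Rightarrow> bool" where
  "decaying_navier_stokes_solution n r0 p rp K um \<mu> \<rho> u \<longleftrightarrow>
     navier_stokes_solution n r0 p rp um \<mu> \<rho> u \<and> decay_estimates n r0 rp um K \<rho> u"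

end

theory Submission
  imports Defs
begin

text \<open>
  For the Euler problem, mass conservation and Bernoulli's law reduce the system to the scalar
  equation \<open>\<rho>\<^sup>2 (h(\<rho>\<^sub>+) - h(\<rho>)) = m\<^sup>2 / (2 r\<^bsup>2(n-1)\<^esup>)\<close>, where \<open>h' = p'/\<rho>\<close> and \<open>m\<close> is the mass
  flux, itself determined by \<open>u\<^sub>-\<close>. Near \<open>\<rho>\<^sub>+\<close> the left side is strictly decreasing in \<open>\<rho>\<close>, and a
  solution cannot leave this neighbourhood by continuity.

  For the viscous flow, the divergence \<open>w\<close> of the velocity satisfies a first order equation
  \<open>\<mu> w\<^sub>r = a w - b\<close> with \<open>a > 0\<close> and \<open>b \<ge> 0\<close>. Once \<open>w\<close> leaves \<open>[0, sup b/a]\<close> it stays away from it,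
  which would make \<open>\<rho>\<close> unbounded; hence \<open>w\<close> is bounded independently of \<open>\<mu>\<close>. Integrating the
  momentum equation divided by \<open>\<rho>\<close> from infinity then shows that Bernoulli's law holds up to
  \<open>O(\<mu>)\<close>, and the scalar equation above turns this into the convergence rate.
\<close>

section \<open>Functions with derivatives of all orders\<close>

text \<open>Order \<open>0\<close> imposes nothing, not even continuity.\<close>

primrec times_differentiable_on :: "nat \<Rightarrow> real set \<Rightarrow> (real \<Rightarrow> real) \<Rightarrow> bool" where
  "times_differentiable_on 0 S f \<longleftrightarrow> True"
| "times_differentiable_on (Suc k) S f \<longleftrightarrow>
     (\<exists>f'. (\<forall>x\<in>S. (f has_real_derivative f' x) (at x within S)) \<and> times_differentiable_on k S f')"

lemma times_differentiable_on_Suc_D: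
  "times_differentiable_on (Suc k) S f \<Longrightarrow> times_differentiable_on k S f"
  by (induction k arbitrary: f) (simp, (metis times_differentiable_on.simps(2)))

lemma times_differentiable_on_cong:
  assumes "times_differentiable_on k S f" "\<And>x. x \<in> S \<Longrightarrow> f x = g x"
  shows "times_differentiable_on k S g"
proof (cases k)
  case (Suc j)
  then obtain f' where f': "\<forall>x\<in>S. (f has_real_derivative f' x) (at x within S)"
    and "times_differentiable_on j S f'"
    using assms(1) by auto
  moreover have "(g has_real_derivative f' x) (at x within S)" if "x \<in> S" for x
    using has_field_derivative_transform_within[OF f'[rule_format, OF that] zero_less_one that]
      assms(2) by blast
  ultimately show ?thesis
    using Suc by auto
qed auto

lemma times_differentiable_on_const [simp]: "times_differentiable_on k S (\<lambda>x. c)"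
  by (induction k arbitrary: c) (auto intro!: exI[of _ "\<lambda>x. 0"])

lemma times_differentiable_on_ident [simp]: "times_differentiable_on k S (\<lambda>x. x)"
  by (cases k) (auto intro!: exI[of _ "\<lambda>x. 1"])

lemma times_differentiable_on_add:
  assumes "times_differentiable_on k S f" "times_differentiable_on k S g"
  shows "times_differentiable_on k S (\<lambda>x. f x + g x)"
  using assms
proof (induction k arbitrary: f g)
  case (Suc k)
  then obtain f' g' where *: "\<forall>x\<in>S. (f has_real_derivative f' x) (at x within S)"
    "times_differentiable_on k S f'" "\<forall>x\<in>S. (g has_real_derivative g' x) (at x within S)"
    "times_differentiable_on k S g'"
    by auto
  then show ?case
    using Suc.IH[of f' g'] by (auto intro!: exI[of _ "\<lambda>x. f' x + g' x"] derivative_eq_intros)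
qed auto

lemma times_differentiable_on_mult:
  assumes "times_differentiable_on k S f" "times_differentiable_on k S g"
  shows "times_differentiable_on k S (\<lambda>x. f x * g x)"
  using assms
proof (induction k arbitrary: f g)
  case (Suc k)
  then obtain f' g' where *: "\<forall>x\<in>S. (f has_real_derivative f' x) (at x within S)"
    "times_differentiable_on k S f'" "\<forall>x\<in>S. (g has_real_derivative g' x) (at x within S)"
    "times_differentiable_on k S g'"
    by auto
  have fg: "times_differentiable_on k S f" "times_differentiable_on k S g"
    using Suc.prems times_differentiable_on_Suc_D by auto
  show ?case
    using * times_differentiable_on_add[OF Suc.IH[OF *(2) fg(2)] Suc.IH[OF fg(1) *(4)]]
    by (auto intro!: exI[of _ "\<lambda>x. f' x * g x + f x * g' x"] derivative_eq_intros)
qed auto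

lemma times_differentiable_on_compose:
  assumes "times_differentiable_on k T f" "times_differentiable_on k S g" "g ` S \<subseteq> T"
  shows "times_differentiable_on k S (\<lambda>x. f (g x))"
  using assms
proof (induction k arbitrary: f)
  case (Suc k)
  then obtain f' g' where *: "\<forall>x\<in>T. (f has_real_derivative f' x) (at x within T)"
    "times_differentiable_on k T f'" "\<forall>x\<in>S. (g has_real_derivative g' x) (at x within S)"
    "times_differentiable_on k S g'"
    by auto
  have g: "times_differentiable_on k S g"
    using Suc.prems times_differentiable_on_Suc_D by auto
  have "((\<lambda>x. f (g x)) has_real_derivative f' (g x) * g' x) (at x within S)" if x: "x \<in> S" for x
  proof -
    have "(f has_real_derivative f' (g x)) (at (g x) within g ` S)"
      using * x Suc.prems(3) by (meson has_field_derivative_subset image_subset_iff)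
    then show ?thesis
      using DERIV_image_chain[of f "f' (g x)" g x S "g' x"] * x by (auto simp: o_def)
  qed
  then show ?case
    using times_differentiable_on_mult[OF Suc.IH[OF *(2) g Suc.prems(3)] *(4)]
    by (auto intro!: exI[of _ "\<lambda>x. f' (g x) * g' x"])
qed auto

lemma times_differentiable_on_inverse_ident:
  assumes "0 \<notin> S"
  shows "times_differentiable_on k S inverse"
proof (induction k)
  case (Suc k)
  \<comment> \<open>The derivative is expressed through \<open>inverse\<close> alone, so the
    induction hypothesis and the product rule cover it.\<close>
  have "(inverse has_real_derivative (- 1) * (inverse x * inverse x)) (at x within S)"
    if "x \<in> S" for x :: real
    using that assms
    by (auto intro!: derivative_eq_intros simp: field_simps power2_eq_square)
  moreover have "times_differentiable_on k S (\<lambda>x. (- 1) * (inverse x * inverse x))"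
    by (intro times_differentiable_on_mult Suc times_differentiable_on_const)
  ultimately show ?case
    unfolding times_differentiable_on.simps
    by (intro exI[of _ "\<lambda>x. (- 1) * (inverse x * inverse x)"]) auto
qed auto

lemma times_differentiable_on_inverse:
  assumes "times_differentiable_on k S f" "\<And>x. x \<in> S \<Longrightarrow> f x \<noteq> 0"
  shows "times_differentiable_on k S (\<lambda>x. inverse (f x))"
  using assms by (intro times_differentiable_on_compose[OF times_differentiable_on_inverse_ident[of "- {0}"]]) auto

lemma times_differentiable_on_power:
  "times_differentiable_on k S f \<Longrightarrow> times_differentiable_on k S (\<lambda>x. f x ^ j)"
  by (induction j) (auto intro: times_differentiable_on_mult)

lemma times_differentiable_on_subset:
  "times_differentiable_on k S f \<Longrightarrow> T \<subseteq> S \<Longrightarrow> times_differentiable_on k T f"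
  using times_differentiable_on_compose[of k S f T "\<lambda>x. x"] by auto

lemma smooth_on_imp_times_differentiable_on:
  assumes "smooth_on S f"
  shows "times_differentiable_on k S f"
proof -
  obtain D where D0: "\<forall>x\<in>S. D 0 x = f x"
    and D: "\<forall>k. \<forall>x\<in>S. (D k has_real_derivative D (Suc k) x) (at x within S)"
    using assms by (auto simp: smooth_on_def)
  have "times_differentiable_on k S (D j)" for j
    by (induction k arbitrary: j) (use D in auto)
  then show ?thesis
    using times_differentiable_on_cong D0 by blast
qed

lemma smooth_on_imp_smooth_derivative:
  assumes "smooth_on S f"
  obtains f' where "smooth_on S f'" "\<And>x. x \<in> S \<Longrightarrow> (f has_real_derivative f' x) (at x within S)"
proof -
  obtain D where D0: "\<forall>x\<in>S. D 0 x = f x"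
    and D: "\<forall>k. \<forall>x\<in>S. (D k has_real_derivative D (Suc k) x) (at x within S)"
    using assms by (auto simp: smooth_on_def)
  have "smooth_on S (D 1)"
    unfolding smooth_on_def by (rule exI[of _ "\<lambda>k. D (Suc k)"]) (use D in auto)
  moreover have "(f has_real_derivative D 1 x) (at x within S)" if "x \<in> S" for x
    using has_field_derivative_transform_within[OF D[rule_format, OF that, of 0] zero_less_one that]
      D0 by simp
  ultimately show ?thesis
    using that by blast
qed

text \<open>Each finite order comes with its own chain of derivatives, whereas
  \<open>smooth_on\<close> asks for a single infinite chain. Where \<open>at x within S\<close> is
  nontrivial, derivatives within \<open>S\<close> are unique, so all first derivatives agree on
  \<open>S\<close> and one of them is again differentiable to every order; dependent choice then
  builds the chain.\<close>

lemma times_differentiable_on_imp_smooth_on: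
  assumes f: "\<And>k. times_differentiable_on k S f" and S: "\<And>x. x \<in> S \<Longrightarrow> at x within S \<noteq> bot"
  shows "smooth_on S f"
proof -
  let ?P = "\<lambda>(k :: nat) g. \<forall>j. times_differentiable_on j S g"
  have "\<exists>D. \<forall>k. ?P k (D k) \<and> (\<forall>x\<in>S. (D k has_real_derivative D (Suc k) x) (at x within S)) \<and> D 0 = f"
  proof -
    have *: "\<exists>h. ?P 0 h \<and> (\<forall>x\<in>S. (g has_real_derivative h x) (at x within S))"
      if g: "?P 0 g" for g
    proof -
      have "\<forall>j. \<exists>h. (\<forall>x\<in>S. (g has_real_derivative h x) (at x within S)) \<and> times_differentiable_on j S h"
        using g by (metis times_differentiable_on.simps(2))
      then obtain H where H: "\<And>j x. x \<in> S \<Longrightarrow> (g has_real_derivative H j x) (at x within S)"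
        "\<And>j. times_differentiable_on j S (H j)"
        by metis
      have "H j x = H 0 x" if "x \<in> S" for j x
        using has_field_derivative_unique[OF H(1)[OF that, of j] H(1)[OF that, of 0] S[OF that]] .
      then have "times_differentiable_on j S (H 0)" for j
        using times_differentiable_on_cong[OF H(2)[of j]] by blast
      then show ?thesis
        using H(1) by blast
    qed
    \<comment> \<open>The clause for \<open>k = 0\<close> pins the start of the chosen sequence to
      \<open>f\<close>.\<close>
    have "\<exists>D. \<forall>k. (?P k (D k) \<and> (k = 0 \<longrightarrow> D k = f)) \<and>
        (\<forall>x\<in>S. (D k has_real_derivative D (Suc k) x) (at x within S))"
    proof (rule dependent_nat_choice)
      show "\<exists>g. ?P 0 g \<and> (0 = (0 :: nat) \<longrightarrow> g = f)"
        using f by blast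
    next
      fix g k
      assume "?P k g \<and> (k = 0 \<longrightarrow> g = f)"
      then show "\<exists>h. (?P (Suc k) h \<and> (Suc k = 0 \<longrightarrow> h = f)) \<and>
          (\<forall>x\<in>S. (g has_real_derivative h x) (at x within S))"
        using *[of g] by auto
    qed
    then show ?thesis
      by blast
  qed
  then show ?thesis
    unfolding smooth_on_def by metis
qed

lemma smooth_on_continuous_on: "smooth_on S f \<Longrightarrow> continuous_on S f"
  by (meson DERIV_continuous continuous_on_eq_continuous_within smooth_on_imp_smooth_derivative)

lemma at_within_atLeast_neq_bot: "r \<in> {a..} \<Longrightarrow> at r within {a..} \<noteq> bot" for a r :: real
  using at_le[of "{r<..}" "{a..}" r] trivial_limit_at_right_real[of r]
  by (metis atLeast_iff bot_unique greaterThan_iff less_imp_le order_trans subsetI)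

text \<open>Bootstrapping: the derivative of \<open>g\<close> is the reciprocal of the derivative of
  \<open>f\<close> taken at \<open>g\<close>, so \<open>k\<close> orders for \<open>g\<close> yield
  one more.\<close>

lemma times_differentiable_on_inverse_function:
  assumes f: "smooth_on S f" and S: "open S"
    and g: "\<And>x. x \<in> S \<Longrightarrow> g (f x) = x"
    and f': "\<And>x. x \<in> S \<Longrightarrow> (f has_real_derivative f' x) (at x)" "\<And>x. x \<in> S \<Longrightarrow> f' x \<noteq> 0"
  shows "times_differentiable_on k (f ` S) g"
proof (induction k)
  case (Suc k)
  \<comment> \<open>No regularity is attached to \<open>f'\<close>; \<open>F\<close> agrees with it
    on the open set \<open>S\<close> and is smooth.\<close>
  obtain F where F: "smooth_on S F" "\<And>x. x \<in> S \<Longrightarrow> (f has_real_derivative F x) (at x within S)"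
    using smooth_on_imp_smooth_derivative[OF f] by metis
  have FS: "F x = f' x" if "x \<in> S" for x
    using DERIV_unique F(2)[OF that] f'(1)[OF that] by (simp add: at_within_open[OF that S])
  have "(g has_real_derivative inverse (F (g y))) (at y within f ` S)" if "y \<in> f ` S" for y
  proof -
    obtain x where x: "x \<in> S" "y = f x"
      using \<open>y \<in> f ` S\<close> by blast
    have "(g has_real_derivative inverse (F x)) (at (f x))"
      unfolding has_field_derivative_def
      by (rule has_derivative_inverse_strong[of S x f g "(*) (f' x)"])
        (use FS x f' S g smooth_on_continuous_on[OF f] in \<open>auto simp: has_field_derivative_def\<close>)
    then show ?thesis
      using x g by (auto intro: has_field_derivative_at_within)
  qed
  moreover have "times_differentiable_on k (f ` S) (\<lambda>y. inverse (F (g y)))"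
    by (intro times_differentiable_on_inverse
        times_differentiable_on_compose[OF smooth_on_imp_times_differentiable_on[OF F(1)] Suc])
      (use g FS f' in auto)
  ultimately show ?case
    unfolding times_differentiable_on.simps
    by (intro exI[of _ "\<lambda>y. inverse (F (g y))"] conjI ballI)
qed auto

section \<open>Differential inequalities on a half-line\<close>

text \<open>Consider the last time in \<open>{a..b}\<close> at which \<open>f\<close> is at least
  \<open>c\<close>. The derivative is positive there, so \<open>f\<close> exceeds \<open>c\<close>
  just afterwards as well; that time must therefore be \<open>b\<close>.\<close>

lemma stays_above_threshold:
  fixes f f' :: "real \<Rightarrow> real"
  assumes f: "\<And>s. s \<ge> a \<Longrightarrow> (f has_real_derivative f' s) (at s)"
    and pos: "\<And>s. s \<ge> a \<Longrightarrow> c \<le> f s \<Longrightarrow> f' s > 0"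
    and "c \<le> f a" "a \<le> b"
  shows "c \<le> f b"
proof (rule ccontr)
  assume b: "\<not> c \<le> f b"
  define A where "A = {a..b} \<inter> f -` {c..}"
  have "continuous_on {a..b} f"
    using f by (meson DERIV_continuous atLeastAtMost_iff continuous_at_imp_continuous_on)
  then have "closed A"
    unfolding A_def by (metis closed_atLeast closed_atLeastAtMost closed_vimage_Int inf_commute)
  then have "compact A"
    unfolding A_def by (metis closed_Int_compact compact_Icc inf.left_idem inf.commute)
  moreover have "A \<noteq> {}"
    using assms by (auto simp: A_def)
  ultimately obtain s where s: "s \<in> A" "\<And>t. t \<in> A \<Longrightarrow> t \<le> s"
    using compact_attains_sup by metis
  have sb: "a \<le> s" "s < b" "c \<le> f s"
    using s b by (auto simp: A_def less_le)
  then obtain d where d: "d > 0" "\<And>e. e > 0 \<Longrightarrow> e < d \<Longrightarrow> f s < f (s + e)"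
    using DERIV_pos_inc_right[OF f pos, of s] by blast
  define e where "e = min (d / 2) (b - s)"
  have "0 < e" "e < d" "s + e \<le> b"
    using d(1) sb by (auto simp: e_def)
  then have "s + e \<in> A"
    using d(2)[of e] sb by (auto simp: A_def)
  then show False
    using s(2)[of "s + e"] d(1) sb by (auto simp: e_def)
qed

lemma unbounded_of_derivative_ge:
  fixes f f' :: "real \<Rightarrow> real"
  assumes f: "\<And>s. s \<ge> a \<Longrightarrow> (f has_real_derivative f' s) (at s)"
    and "\<And>s. s \<ge> a \<Longrightarrow> k \<le> f' s" and "k > 0"
    and B: "\<And>s. s \<ge> a \<Longrightarrow> \<bar>f s\<bar> \<le> B"
  shows False
proof -
  \<comment> \<open>Growth at rate \<open>k\<close> up to this point amounts to
    \<open>2 * B + 1\<close>, more than the oscillation \<open>2 * B\<close> that the bound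
    permits.\<close>
  define b where "b = a + (2 * B + 1) / k"
  have "B \<ge> 0"
    using B[of a] by simp
  then have ab: "a < b"
    using \<open>k > 0\<close> by (simp add: b_def)
  then obtain z where z: "a < z" "z < b" "f b - f a = (b - a) * f' z"
    using MVT2[of a b f f'] f by auto
  have "(b - a) * k \<le> (b - a) * f' z"
    using ab z assms by (intro mult_left_mono) auto
  moreover have "(b - a) * k = 2 * B + 1"
    using \<open>k > 0\<close> by (simp add: b_def)
  ultimately show False
    using z B[of a] B[of b] ab by auto
qed

text \<open>Integration from infinity without integrals: \<open>F\<close> is nondecreasing,
  \<open>F s + k / s\<close> is nonincreasing, and both tend to \<open>0\<close>.\<close>

lemma bounds_of_decaying_antiderivative:
  fixes F F' :: "real \<Rightarrow> real"
  assumes "r0 > 0" and F: "\<And>s. s > r0 \<Longrightarrow> (F has_real_derivative F' s) (at s)"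
    and F': "\<And>s. s > r0 \<Longrightarrow> 0 \<le> F' s" "\<And>s. s > r0 \<Longrightarrow> F' s \<le> k / s\<^sup>2"
    and lim: "(F \<longlongrightarrow> 0) at_top" and r: "r > r0"
  shows "- (k / r) \<le> F r" "F r \<le> 0"
proof -
  have "F r \<le> F s" if "r \<le> s" for s
  proof (rule DERIV_nonneg_imp_nondecreasing[OF that])
    fix x assume "r \<le> x"
    then show "\<exists>y. (F has_real_derivative y) (at x) \<and> 0 \<le> y"
      using F[of x] F'(1)[of x] r by auto
  qed
  then show "F r \<le> 0"
    using lim by (intro tendsto_lowerbound[of F 0 at_top]) (auto simp: eventually_at_top_linorder)
  have "F s + k / s \<le> F r + k / r" if "r \<le> s" for s
  proof (rule DERIV_nonpos_imp_nonincreasing[OF that])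
    fix x assume "r \<le> x" "x \<le> s"
    then have x: "x > r0" "x > 0"
      using r \<open>r0 > 0\<close> by auto
    then have "((\<lambda>s. F s + k / s) has_real_derivative (F' x - k / x\<^sup>2)) (at x)"
      using F[of x] by (auto intro!: derivative_eq_intros simp: field_simps power2_eq_square)
    then show "\<exists>y. ((\<lambda>s. F s + k / s) has_real_derivative y) (at x) \<and> y \<le> 0"
      using F'(2)[OF x(1)] by (intro exI[of _ "F' x - k / x\<^sup>2"]) auto
  qed
  moreover have "((\<lambda>s. F s + k / s) \<longlongrightarrow> 0 + 0) at_top"
    by (intro tendsto_add lim tendsto_divide_0[OF tendsto_const] filterlim_at_top_imp_at_infinity filterlim_ident)
  ultimately have "0 \<le> F r + k / r"
    by (intro tendsto_upperbound[of "\<lambda>s. F s + k / s" 0 at_top]) (auto simp: eventually_at_top_linorder)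
  then show "- (k / r) \<le> F r"
    by simp
qed

text \<open>Mean value theorem. A lower bound on the absolute value of the derivative serves the
  increasing enthalpy and the decreasing \<open>flux_fun\<close> alike.\<close>

lemma expansive_of_derivative_ge:
  fixes f f' :: "real \<Rightarrow> real"
  assumes "\<And>x. x \<in> {a..b} \<Longrightarrow> (f has_real_derivative f' x) (at x)"
    and "\<And>x. x \<in> {a..b} \<Longrightarrow> c \<le> \<bar>f' x\<bar>"
    and "x \<in> {a..b}" "y \<in> {a..b}"
  shows "c * \<bar>x - y\<bar> \<le> \<bar>f x - f y\<bar>"
  using assms(3,4)
proof (induction x y rule: linorder_wlog)
  case (le x y)
  show ?case
  proof (cases "x = y")
    case False
    then obtain z where z: "x < z" "z < y" "f y - f x = (y - x) * f' z"
      using MVT2[of x y f f'] le assms(1) by auto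
    then have "c * \<bar>y - x\<bar> \<le> \<bar>f' z\<bar> * \<bar>y - x\<bar>"
      using assms(2)[of z] le by (intro mult_right_mono) auto
    also have "\<dots> = \<bar>f y - f x\<bar>"
      using z by (simp add: abs_mult)
    finally show ?thesis
      by (simp add: abs_minus_commute)
  qed auto
qed (simp add: abs_minus_commute)

section \<open>Interior derivatives on the half-line and conservation of mass\<close>

lemma smooth_on_atLeast_derivative:
  assumes "smooth_on {r0..} f"
  obtains f' where "smooth_on {r0..} f'" "\<And>r. r > r0 \<Longrightarrow> (f has_real_derivative f' r) (at r)"
proof -
  obtain f' where "smooth_on {r0..} f'" and
    f': "\<And>r. r \<in> {r0..} \<Longrightarrow> (f has_real_derivative f' r) (at r within {r0..})"
    using smooth_on_imp_smooth_derivative[OF assms] by metis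
  moreover have "(f has_real_derivative f' r) (at r)" if "r > r0" for r
    using f'[of r] at_within_interior[of r "{r0..}"] that by simp
  ultimately show ?thesis
    using that by blast
qed

lemma constant_on_atLeast:
  fixes f :: "real \<Rightarrow> real"
  assumes "continuous_on {r0..} f" "\<And>r. r > r0 \<Longrightarrow> (f has_real_derivative 0) (at r)" "r \<ge> r0"
  shows "f r = f r0"
proof (cases "r = r0")
  case False
  have "continuous_on {r0..r} f"
    using assms(1) by (rule continuous_on_subset) auto
  then show ?thesis
    using False assms by (intro DERIV_isconst_end[of r0 r f]) auto
qed auto

lemma mass_conservation:
  assumes "smooth_on {r0..} \<rho>" "smooth_on {r0..} u"
    and "\<And>r. r > r0 \<Longrightarrow> deriv (\<lambda>s. s ^ q * \<rho> s * u s) r = 0" and "r \<ge> r0"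
  shows "r ^ q * \<rho> r * u r = r0 ^ q * \<rho> r0 * u r0"
proof (rule constant_on_atLeast[of r0 "\<lambda>r. r ^ q * \<rho> r * u r"])
  show "continuous_on {r0..} (\<lambda>r. r ^ q * \<rho> r * u r)"
    using assms(1,2) by (intro continuous_intros smooth_on_continuous_on)
  fix r assume r: "r > r0"
  obtain \<rho>' u' where "(\<rho> has_real_derivative \<rho>' r) (at r)" "(u has_real_derivative u' r) (at r)"
    using smooth_on_atLeast_derivative assms(1,2) r by metis
  \<comment> \<open>A vanishing \<open>deriv\<close> carries information only once differentiability
    is known; smoothness supplies it.\<close>
  then have "(\<lambda>s. s ^ q * \<rho> s * u s) field_differentiable at r"
    by (intro field_differentiable_mult field_differentiable_power field_differentiable_ident)
      (auto simp: field_differentiable_def)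
  then show "((\<lambda>s. s ^ q * \<rho> s * u s) has_real_derivative 0) (at r)"
    using assms(3)[OF r] by (simp add: field_differentiable_derivI flip: assms(3)[OF r])
qed fact

section \<open>Barotropic flow near the far-field density\<close>

text \<open>
  \<open>q\<close> is \<open>n - 1\<close> and \<open>h\<close> the enthalpy; expressed through the constant mass flux, Bernoulli's law reads
  \<open>flux_fun \<rho> = (r\<^sup>q \<rho> u)\<^sup>2 / (2 r\<^bsup>2q\<^esup>)\<close>.
\<close>

locale barotropic_flow =
  fixes q :: nat and r0 rp :: real and p p' h :: "real \<Rightarrow> real" and \<delta> c :: real
  assumes q: "q \<ge> 1" and r0: "r0 > 0" and rp: "rp > 0"
    and p_deriv: "\<And>x. x > 0 \<Longrightarrow> (p has_real_derivative p' x) (at x)"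
    and p'_pos: "\<And>x. x > 0 \<Longrightarrow> p' x > 0"
    and h_smooth: "smooth_on {0<..} h"
    and h_deriv: "\<And>x. x > 0 \<Longrightarrow> (h has_real_derivative p' x / x) (at x)"
    and \<delta>: "0 < \<delta>" "\<delta> \<le> rp / 2" and c: "0 < c"
    and c_le_p': "\<And>x. x \<in> {rp - \<delta>..rp + \<delta>} \<Longrightarrow> c \<le> p' x"
    and c_le_h': "\<And>x. x \<in> {rp - \<delta>..rp + \<delta>} \<Longrightarrow> c \<le> p' x / x"
    and c_le_flux': "\<And>x. x \<in> {rp - \<delta>..rp + \<delta>} \<Longrightarrow> c \<le> x * p' x - 2 * x * (h rp - h x)"
begin

definition flux_fun :: "real \<Rightarrow> real" where
  "flux_fun x = x\<^sup>2 * (h rp - h x)"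

text \<open>Total head relative to the state at infinity: zero along Euler flows, and the quantity
  to be shown of order \<mu> for viscous ones.\<close>

definition bernoulli_defect :: "(real \<Rightarrow> real) \<Rightarrow> (real \<Rightarrow> real) \<Rightarrow> real \<Rightarrow> real" where
  "bernoulli_defect \<rho> u r = (u r)\<^sup>2 / 2 + h (\<rho> r) - h rp"

lemma near_bounds:
  assumes "x \<in> {rp - \<delta>..rp + \<delta>}"
  shows "x > 0" "rp / 2 \<le> x" "x \<le> 3 / 2 * rp"
  using assms \<delta> rp by auto

section \<open>Monotonicity and inversion of the enthalpy and of \<open>flux_fun\<close>\<close>

lemma h_strict_mono:
  assumes "0 < x" "x < y" shows "h x < h y"
proof (rule DERIV_pos_imp_increasing[OF assms(2)])
  fix z assume "x \<le> z"
  then have "z > 0"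
    using assms by simp
  then show "\<exists>l. (h has_real_derivative l) (at z) \<and> 0 < l"
    using h_deriv p'_pos by (blast intro: divide_pos_pos)
qed

lemma h_le_iff: "0 < x \<Longrightarrow> 0 < y \<Longrightarrow> h x \<le> h y \<longleftrightarrow> x \<le> y"
  using h_strict_mono by (metis linorder_not_less order_less_imp_le order_le_less)

lemma h_eq_iff: "0 < x \<Longrightarrow> 0 < y \<Longrightarrow> h x = h y \<longleftrightarrow> x = y"
  by (simp add: h_le_iff order_eq_iff)

lemma h_continuous_on: "S \<subseteq> {0<..} \<Longrightarrow> continuous_on S h"
  using smooth_on_continuous_on[OF h_smooth] continuous_on_subset by blast

lemma flux_fun_deriv:
  assumes "x > 0"
  shows "(flux_fun has_real_derivative 2 * x * (h rp - h x) - x * p' x) (at x)"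
  unfolding flux_fun_def[abs_def]
  using assms h_deriv[OF assms]
  by (auto intro!: derivative_eq_intros simp: power2_eq_square)

lemma flux_fun_continuous_on: "S \<subseteq> {0<..} \<Longrightarrow> continuous_on S flux_fun"
  unfolding flux_fun_def[abs_def] by (intro continuous_intros h_continuous_on)

lemma h_expansive:
  assumes "x \<in> {rp - \<delta>..rp + \<delta>}" "y \<in> {rp - \<delta>..rp + \<delta>}"
  shows "c * \<bar>x - y\<bar> \<le> \<bar>h x - h y\<bar>"
proof (rule expansive_of_derivative_ge[OF _ _ assms])
  fix z assume z: "z \<in> {rp - \<delta>..rp + \<delta>}"
  show "(h has_real_derivative p' z / z) (at z)"
    using h_deriv near_bounds[OF z] by blast
  show "c \<le> \<bar>p' z / z\<bar>"
    using c_le_h'[OF z] by linarith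
qed

lemma flux_fun_expansive:
  assumes "x \<in> {rp - \<delta>..rp + \<delta>}" "y \<in> {rp - \<delta>..rp + \<delta>}"
  shows "c * \<bar>x - y\<bar> \<le> \<bar>flux_fun x - flux_fun y\<bar>"
proof (rule expansive_of_derivative_ge[OF _ _ assms])
  fix z assume z: "z \<in> {rp - \<delta>..rp + \<delta>}"
  show "(flux_fun has_real_derivative 2 * z * (h rp - h z) - z * p' z) (at z)"
    using flux_fun_deriv near_bounds[OF z] by blast
  \<comment> \<open>The bound \<open>c_le_flux'\<close> concerns minus this derivative:
    \<open>flux_fun\<close> is decreasing near \<open>rp\<close>.\<close>
  show "c \<le> \<bar>2 * z * (h rp - h z) - z * p' z\<bar>"
    using c_le_flux'[OF z] by linarith
qed

lemma flux_fun_inj: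
  "x \<in> {rp - \<delta>..rp + \<delta>} \<Longrightarrow> y \<in> {rp - \<delta>..rp + \<delta>} \<Longrightarrow> flux_fun x = flux_fun y \<Longrightarrow> x = y"
  using flux_fun_expansive[of x y] c by (simp add: mult_le_0_iff)

lemma flux_fun_rp [simp]: "flux_fun rp = 0"
  by (simp add: flux_fun_def)

text \<open>The barrier of the continuity argument: a density at which \<open>flux_fun\<close> is
  below \<open>c * \<delta>\<close> cannot equal \<open>rp - \<delta>\<close>.\<close>

lemma flux_fun_left_end: "c * \<delta> \<le> flux_fun (rp - \<delta>)"
proof -
  have "h (rp - \<delta>) \<le> h rp"
    using h_le_iff[of "rp - \<delta>" rp] \<delta> rp by auto
  then have "flux_fun (rp - \<delta>) \<ge> 0"
    by (simp add: flux_fun_def)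
  then show ?thesis
    using flux_fun_expansive[of "rp - \<delta>" rp] \<delta> by auto
qed

lemma h_left_end: "c * \<delta> \<le> h rp - h (rp - \<delta>)"
  using h_expansive[of "rp - \<delta>" rp] h_le_iff[of "rp - \<delta>" rp] \<delta> rp by auto

lemma h_inverse_exists:
  assumes "0 \<le> t" "t \<le> c * \<delta>"
  obtains x where "x \<in> {rp - \<delta>..rp}" "h x = h rp - t"
proof -
  have "\<exists>x\<ge>rp - \<delta>. x \<le> rp \<and> h x = h rp - t"
    using assms h_left_end \<delta> rp by (intro IVT') (auto intro!: h_continuous_on)
  then show ?thesis
    using that by auto
qed

text \<open>The strict bound on \<open>t\<close> excludes the left end, so the root lies in the open
  neighbourhood on which \<open>flux_fun\<close> is later inverted smoothly.\<close>

lemma flux_fun_inverse_exists: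
  assumes "0 \<le> t" "t < c * \<delta>"
  obtains x where "x \<in> {rp - \<delta><..rp}" "flux_fun x = t"
proof -
  have "\<exists>x\<ge>rp - \<delta>. x \<le> rp \<and> flux_fun x = t"
    using assms flux_fun_left_end \<delta> rp by (intro IVT2') (auto intro!: flux_fun_continuous_on)
  then obtain x where "rp - \<delta> \<le> x" "x \<le> rp" "flux_fun x = t"
    by blast
  moreover have "x \<noteq> rp - \<delta>"
    using calculation assms flux_fun_left_end by auto
  ultimately show ?thesis
    using that[of x] by auto
qed

section \<open>Limit, derivative and continuity of the Bernoulli defect\<close>

lemma bernoulli_defect_tendsto:
  assumes "far_field_and_boundary r0 rp um \<rho> u"
  shows "(bernoulli_defect \<rho> u \<longlongrightarrow> 0) at_top"
proof -
  have lim: "(\<rho> \<longlongrightarrow> rp) at_top" "(u \<longlongrightarrow> 0) at_top"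
    using assms tendsto_fst tendsto_snd by (fastforce simp: far_field_and_boundary_def)+
  have "((\<lambda>r. h (\<rho> r)) \<longlongrightarrow> h rp) at_top"
    using lim(1) h_deriv[OF rp] by (intro isCont_tendsto_compose[of rp h]) (auto intro: DERIV_isCont)
  then have "((\<lambda>r. (u r)\<^sup>2 / 2 + h (\<rho> r) - h rp) \<longlongrightarrow> 0\<^sup>2 / 2 + h rp - h rp) at_top"
    using lim by (intro tendsto_intros) auto
  then show ?thesis
    by (simp add: bernoulli_defect_def[abs_def])
qed

lemma bernoulli_defect_deriv:
  assumes "(\<rho> has_real_derivative \<rho>') (at r)" "(u has_real_derivative u') (at r)" "\<rho> r > 0"
  shows "(bernoulli_defect \<rho> u has_real_derivative u r * u' + p' (\<rho> r) / \<rho> r * \<rho>') (at r)"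
  unfolding bernoulli_defect_def[abs_def]
  using DERIV_chain2[OF h_deriv[OF assms(3)] assms(1)] assms(2)
  by (auto intro!: derivative_eq_intros)

lemma bernoulli_defect_continuous_on:
  assumes "smooth_on {r0..} \<rho>" "smooth_on {r0..} u" "\<And>r. r \<ge> r0 \<Longrightarrow> \<rho> r > 0"
  shows "continuous_on {r0..} (bernoulli_defect \<rho> u)"
  unfolding bernoulli_defect_def[abs_def] using assms
  by (intro continuous_intros continuous_on_compose2[OF h_continuous_on[of "{0<..}"]]
      smooth_on_continuous_on) auto

section \<open>The stationary Euler problem\<close>

text \<open>The momentum equation divided by the density says that the defect has derivative zero;
  its constant value is its limit \<open>0\<close> at infinity.\<close>

lemma euler_bernoulli:
  assumes "euler_solution (Suc q) r0 p rp um \<rho> u" "r \<ge> r0"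
  shows "(u r)\<^sup>2 / 2 = h rp - h (\<rho> r)"
proof -
  have sm: "smooth_on {r0..} \<rho>" "smooth_on {r0..} u" and pos: "\<And>r. r \<ge> r0 \<Longrightarrow> \<rho> r > 0"
    and eq: "\<And>r. r > r0 \<Longrightarrow> \<rho> r * u r * deriv u r + deriv (\<lambda>s. p (\<rho> s)) r = 0"
    and ff: "far_field_and_boundary r0 rp um \<rho> u"
    using assms(1) by (auto simp: euler_solution_def)
  have const: "bernoulli_defect \<rho> u r = bernoulli_defect \<rho> u r0" if "r \<ge> r0" for r
  proof (rule constant_on_atLeast[OF bernoulli_defect_continuous_on[OF sm pos] _ that])
    fix r assume r: "r > r0"
    obtain \<rho>' u' where d: "(\<rho> has_real_derivative \<rho>' r) (at r)" "(u has_real_derivative u' r) (at r)"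
      using smooth_on_atLeast_derivative sm r by metis
    have "\<rho> r > 0"
      using pos r by simp
    have "((\<lambda>s. p (\<rho> s)) has_real_derivative p' (\<rho> r) * \<rho>' r) (at r)"
      using DERIV_chain2[OF p_deriv[OF \<open>\<rho> r > 0\<close>] d(1)] .
    then have "\<rho> r * u r * u' r + p' (\<rho> r) * \<rho>' r = 0"
      using eq[OF r] d by (simp add: DERIV_imp_deriv)
    then have zero: "u r * u' r + p' (\<rho> r) / \<rho> r * \<rho>' r = 0"
      using \<open>\<rho> r > 0\<close> by (simp add: field_simps)
    show "(bernoulli_defect \<rho> u has_real_derivative 0) (at r)"
      using bernoulli_defect_deriv[OF d \<open>\<rho> r > 0\<close>] unfolding zero .
  qed
  have "\<forall>\<^sub>F r in at_top. bernoulli_defect \<rho> u r = bernoulli_defect \<rho> u r0"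
    using eventually_ge_at_top[of r0] by eventually_elim (rule const)
  then have "(bernoulli_defect \<rho> u \<longlongrightarrow> bernoulli_defect \<rho> u r0) at_top"
    by (rule tendsto_eventually)
  then have "bernoulli_defect \<rho> u r0 = 0"
    using bernoulli_defect_tendsto[OF ff] tendsto_unique trivial_limit_at_top_linorder by blast
  then show ?thesis
    using const[OF assms(2)] by (simp add: bernoulli_defect_def)
qed

text \<open>Bernoulli's law caps the density at \<open>rp\<close>, the value
  \<open>rp - \<delta>\<close> would need too large a mass flux, and the density starts above it at
  \<open>r0\<close>. Only the data are small, so the later uniqueness result is not confined to
  solutions assumed close to \<open>rp\<close>.\<close>

lemma euler_density_near:
  assumes sol: "euler_solution (Suc q) r0 p rp um \<rho> u" and r: "r \<ge> r0"
    and small: "rp\<^sup>2 * um\<^sup>2 < c * \<delta>" "um\<^sup>2 / 2 < c * \<delta>"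
  shows "\<rho> r \<in> {rp - \<delta><..rp}"
proof -
  have sm: "smooth_on {r0..} \<rho>" "smooth_on {r0..} u" and pos: "\<And>r. r \<ge> r0 \<Longrightarrow> \<rho> r > 0"
    and eq: "\<And>r. r > r0 \<Longrightarrow> deriv (\<lambda>s. s ^ q * \<rho> s * u s) r = 0"
    and u0: "u r0 = um"
    using sol by (auto simp: euler_solution_def far_field_and_boundary_def)
  have le: "\<rho> r \<le> rp" if "r \<ge> r0" for r
  proof -
    have "0 \<le> (u r)\<^sup>2 / 2"
      by simp
    then show ?thesis
      using euler_bernoulli[OF sol that] h_le_iff[OF pos[OF that] rp] by linarith
  qed
  have ne: "\<rho> s \<noteq> rp - \<delta>" if s: "s \<ge> r0" for s
  proof
    assume "\<rho> s = rp - \<delta>"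
    have "flux_fun (\<rho> s) = (\<rho> s * u s)\<^sup>2 / 2"
      using euler_bernoulli[OF sol s] by (simp add: flux_fun_def power_mult_distrib)
    \<comment> \<open>The mass flux equals that at \<open>r0\<close>, where the density is at most
      \<open>rp\<close>; since \<open>r0 ^ q \<le> s ^ q\<close>, the bound is free of
      \<open>s\<close>.\<close>
    moreover have "\<bar>\<rho> s * u s\<bar> \<le> rp * \<bar>um\<bar>"
    proof -
      have "s ^ q * \<bar>\<rho> s * u s\<bar> = r0 ^ q * (\<bar>\<rho> r0\<bar> * \<bar>um\<bar>)"
        using arg_cong[OF mass_conservation[OF sm eq s], of abs] u0 r0 s by (simp add: abs_mult)
      also have "\<dots> \<le> s ^ q * (rp * \<bar>um\<bar>)"
        using s r0 le[of r0] pos[of r0] by (intro mult_mono power_mono) auto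
      finally show ?thesis
        using s r0 by simp
    qed
    then have "(\<rho> s * u s)\<^sup>2 \<le> rp\<^sup>2 * um\<^sup>2"
      using power_mono[of "\<bar>\<rho> s * u s\<bar>" "rp * \<bar>um\<bar>" 2] by (simp add: power_mult_distrib)
    ultimately have "flux_fun (\<rho> s) \<le> rp\<^sup>2 * um\<^sup>2 / 2"
      by simp
    moreover have "0 \<le> rp\<^sup>2 * um\<^sup>2"
      by simp
    ultimately have "flux_fun (\<rho> s) < c * \<delta>"
      using small(1) by linarith
    then show False
      using flux_fun_left_end \<open>\<rho> s = rp - \<delta>\<close> by simp
  qed
  \<comment> \<open>At \<open>r0\<close> the velocity is the given \<open>um\<close>, so Bernoulli's
    law puts the enthalpy there exactly \<open>um\<^sup>2 / 2\<close> below
    \<open>h rp\<close>.\<close>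
  have "h (rp - \<delta>) < h (\<rho> r0)"
    using euler_bernoulli[OF sol order_refl] u0 h_left_end small(2) by simp
  then have start: "rp - \<delta> < \<rho> r0"
    using h_le_iff[of "\<rho> r0" "rp - \<delta>"] pos[of r0] \<delta> rp by (auto simp: not_le)
  have "rp - \<delta> < \<rho> r"
  proof (rule ccontr)
    assume "\<not> rp - \<delta> < \<rho> r"
    then have "\<exists>s\<ge>r0. s \<le> r \<and> \<rho> s = rp - \<delta>"
      using start r smooth_on_continuous_on[OF sm(1)]
      by (intro IVT2') (auto intro: continuous_on_subset)
    then show False
      using ne by blast
  qed
  then show ?thesis
    using le[OF r] by simp
qed

lemma flux_fun_of_bernoulli_defect:
  "flux_fun (\<rho> r) = (\<rho> r * u r)\<^sup>2 / 2 - (\<rho> r)\<^sup>2 * bernoulli_defect \<rho> u r"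
  by (simp add: flux_fun_def bernoulli_defect_def power_mult_distrib algebra_simps)

text \<open>The boundary velocity fixes the boundary density through Bernoulli's law, hence the mass
  flux. At every other radius both densities then have the same value of \<open>flux_fun\<close>,
  which is injective on the neighbourhood that traps them.\<close>

lemma euler_unique:
  assumes sol1: "euler_solution (Suc q) r0 p rp um \<rho>1 u1"
    and sol2: "euler_solution (Suc q) r0 p rp um \<rho>2 u2" and r: "r \<ge> r0"
    and small: "rp\<^sup>2 * um\<^sup>2 < c * \<delta>" "um\<^sup>2 / 2 < c * \<delta>"
  shows "\<rho>1 r = \<rho>2 r" "u1 r = u2 r"
proof -
  have pos: "\<rho>1 r > 0" "\<rho>2 r > 0" "\<rho>1 r0 > 0" "\<rho>2 r0 > 0"
    and eq: "\<And>r. r > r0 \<Longrightarrow> deriv (\<lambda>s. s ^ q * \<rho>1 s * u1 s) r = 0"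
       "\<And>r. r > r0 \<Longrightarrow> deriv (\<lambda>s. s ^ q * \<rho>2 s * u2 s) r = 0"
    and sm: "smooth_on {r0..} \<rho>1" "smooth_on {r0..} u1" "smooth_on {r0..} \<rho>2" "smooth_on {r0..} u2"
    and u0: "u1 r0 = um" "u2 r0 = um"
    using sol1 sol2 r by (auto simp: euler_solution_def far_field_and_boundary_def)
  have "h (\<rho>1 r0) = h (\<rho>2 r0)"
    using euler_bernoulli[OF sol1 order_refl] euler_bernoulli[OF sol2 order_refl] u0 by simp
  then have "\<rho>1 r0 = \<rho>2 r0"
    using h_eq_iff pos by blast
  then have "r ^ q * (\<rho>1 r * u1 r) = r ^ q * (\<rho>2 r * u2 r)"
    using mass_conservation[OF sm(1,2) eq(1) r] mass_conservation[OF sm(3,4) eq(2) r] u0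
    by (simp add: mult.assoc)
  then have flux: "\<rho>1 r * u1 r = \<rho>2 r * u2 r"
    using r r0 by simp
  have flux_fun: "flux_fun (\<rho>1 r) = (\<rho>1 r * u1 r)\<^sup>2 / 2" "flux_fun (\<rho>2 r) = (\<rho>2 r * u2 r)\<^sup>2 / 2"
    using euler_bernoulli[OF sol1 r] euler_bernoulli[OF sol2 r]
    by (simp_all add: flux_fun_def power_mult_distrib)
  have near: "\<rho>1 r \<in> {rp - \<delta>..rp + \<delta>}" "\<rho>2 r \<in> {rp - \<delta>..rp + \<delta>}"
    using euler_density_near[OF sol1 r small] euler_density_near[OF sol2 r small] \<delta>(1) by auto
  show "\<rho>1 r = \<rho>2 r"
    using flux_fun_inj[OF near] flux_fun flux by simp
  then show "u1 r = u2 r"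
    using flux pos by simp
qed

text \<open>Explicit construction: the enthalpy gives the boundary density and thereby the mass
  flux, inverting \<open>flux_fun\<close> gives the density, and mass conservation gives the
  velocity.\<close>

lemma euler_exists:
  assumes small: "rp\<^sup>2 * um\<^sup>2 < c * \<delta>" "um\<^sup>2 / 2 < c * \<delta>"
  obtains \<rho> u where "euler_solution (Suc q) r0 p rp um \<rho> u"
proof -
  define I where "I = {rp - \<delta><..<rp + \<delta>}"
  have I: "I \<subseteq> {rp - \<delta>..rp + \<delta>}" "open I" "rp \<in> I"
    using \<delta> by (auto simp: I_def)
  have Ipos: "x > 0" if "x \<in> I" for x
    using near_bounds(1) I that by blast
  define g where "g = the_inv_into I flux_fun"
  have "inj_on flux_fun I"
    using flux_fun_inj I by (intro inj_onI) blast
  then have g: "g (flux_fun x) = x" if "x \<in> I" for x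
    unfolding g_def using that by (rule the_inv_into_f_f)
  have h_diff: "times_differentiable_on k {0<..} h" for k
    using h_smooth smooth_on_imp_times_differentiable_on by blast
  have flux_diff: "times_differentiable_on k {0<..} flux_fun" for k
  proof -
    \<comment> \<open>The difference is written as a sum with a factor \<open>- 1\<close> to match
      the closure rules for sums and products.\<close>
    have "times_differentiable_on k {0<..} (\<lambda>x. x ^ 2 * (h rp + (- 1) * h x))"
      by (intro times_differentiable_on_mult times_differentiable_on_add times_differentiable_on_const
          times_differentiable_on_power times_differentiable_on_ident h_diff)
    then show ?thesis
      by (simp add: flux_fun_def[abs_def])
  qed
  have "smooth_on I flux_fun"
  proof (rule times_differentiable_on_imp_smooth_on)
    show "times_differentiable_on k I flux_fun" for k
      using times_differentiable_on_subset[OF flux_diff] Ipos by auto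
  qed (use I at_within_open in fastforce)
  then have g_diff: "times_differentiable_on k (flux_fun ` I) g" for k
  proof (rule times_differentiable_on_inverse_function)
    show "open I"
      by fact
    fix x assume x: "x \<in> I"
    show "g (flux_fun x) = x"
      using g x .
    show "(flux_fun has_real_derivative 2 * x * (h rp - h x) - x * p' x) (at x)"
      using flux_fun_deriv Ipos x by blast
    show "2 * x * (h rp - h x) - x * p' x \<noteq> 0"
      using c_le_flux'[of x] I(1) x c by fastforce
  qed
  have range: "t \<in> flux_fun ` I" if "0 \<le> t" "t < c * \<delta>" for t
    using flux_fun_inverse_exists[OF that] \<delta> by (metis I_def greaterThanAtMost_iff
        greaterThanLessThan_iff image_eqI less_add_same_cancel1 order_le_less_trans)
  \<comment> \<open>The boundary density that Bernoulli's law forces for the velocity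
    \<open>um\<close>.\<close>
  obtain x0 where x0: "x0 \<in> {rp - \<delta>..rp}" "h x0 = h rp - um\<^sup>2 / 2"
    using h_inverse_exists[of "um\<^sup>2 / 2"] small by auto
  have x0_pos: "x0 > 0" "x0 \<le> rp"
    using x0 \<delta> rp by auto
  \<comment> \<open>This is \<open>m\<^sup>2 / (2 * r ^ (2 * q))\<close> with the mass flux
    \<open>m = r0 ^ q * x0 * um\<close>, the value that \<open>flux_fun\<close> must take at radius
    \<open>r\<close>.\<close>
  define T where "T r = (r0 ^ q * x0 * um)\<^sup>2 / 2 * (inverse r ^ q)\<^sup>2" for r :: real
  have T_range: "0 \<le> T r" "T r < c * \<delta>" if "r \<ge> r0" for r
  proof -
    show "0 \<le> T r"
      by (simp add: T_def)
    have "\<bar>r0 ^ q * x0 * um * inverse r ^ q\<bar> \<le> 1 * (rp * \<bar>um\<bar>)"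
    proof -
      have "(r0 * inverse r) ^ q \<le> 1"
        using that r0 by (intro power_le_one) (auto simp: field_simps)
      then have "(r0 * inverse r) ^ q * (x0 * \<bar>um\<bar>) \<le> 1 * (rp * \<bar>um\<bar>)"
        using x0_pos that r0 by (intro mult_mono) auto
      then show ?thesis
        using x0_pos that r0 by (simp add: abs_mult power_mult_distrib mult_ac)
    qed
    then have "(r0 ^ q * x0 * um * inverse r ^ q)\<^sup>2 \<le> rp\<^sup>2 * um\<^sup>2"
      using power_mono[of "\<bar>r0 ^ q * x0 * um * inverse r ^ q\<bar>" "1 * (rp * \<bar>um\<bar>)" 2]
      by (simp only: power2_abs power_mult_distrib) simp
    then have "T r \<le> rp\<^sup>2 * um\<^sup>2 / 2"
      by (simp add: T_def power_mult_distrib)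
    moreover have "0 \<le> rp\<^sup>2 * um\<^sup>2"
      by simp
    ultimately show "T r < c * \<delta>"
      using small(1) by linarith
  qed
  define \<rho> where "\<rho> r = g (T r)" for r
  define u where "u r = r0 ^ q * x0 * um * inverse r ^ q * inverse (\<rho> r)" for r
  have \<rho>_I: "\<rho> r \<in> I" "flux_fun (\<rho> r) = T r" if "r \<ge> r0" for r
    using range[OF T_range[OF that]] g by (auto simp: \<rho>_def)
  have \<rho>_pos: "\<rho> r > 0" if "r \<ge> r0" for r
    using \<rho>_I Ipos that by blast
  have inv_diff: "times_differentiable_on k {r0..} (\<lambda>r. inverse r ^ q)" for k
    using r0 by (intro times_differentiable_on_power times_differentiable_on_inverse
        times_differentiable_on_ident) auto
  have \<rho>_diff: "times_differentiable_on k {r0..} \<rho>" for k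
    unfolding \<rho>_def[abs_def] T_def[abs_def]
  proof (rule times_differentiable_on_compose[OF g_diff])
    show "times_differentiable_on k {r0..} (\<lambda>r. (r0 ^ q * x0 * um)\<^sup>2 / 2 * (inverse r ^ q)\<^sup>2)"
      by (intro times_differentiable_on_mult times_differentiable_on_const
          times_differentiable_on_power inv_diff)
    show "(\<lambda>r. (r0 ^ q * x0 * um)\<^sup>2 / 2 * (inverse r ^ q)\<^sup>2) ` {r0..} \<subseteq> flux_fun ` I"
      using range[OF T_range] by (auto simp: T_def)
  qed
  have u_diff: "times_differentiable_on k {r0..} u" for k
    unfolding u_def[abs_def]
    by (intro times_differentiable_on_mult times_differentiable_on_const inv_diff
        times_differentiable_on_inverse \<rho>_diff) (use \<rho>_pos in force)
  have sm: "smooth_on {r0..} \<rho>" "smooth_on {r0..} u"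
    using \<rho>_diff u_diff at_within_atLeast_neq_bot
    by (blast intro: times_differentiable_on_imp_smooth_on)+
  have mass: "r ^ q * \<rho> r * u r = r0 ^ q * x0 * um" if "r \<ge> r0" for r
    using \<rho>_pos[OF that] that r0 by (simp add: u_def field_simps)
  have defect: "bernoulli_defect \<rho> u r = 0" if "r \<ge> r0" for r
  proof -
    have "\<rho> r * u r = r0 ^ q * x0 * um * inverse r ^ q"
      using \<rho>_pos[OF that] by (simp add: u_def)
    then have "(\<rho> r * u r)\<^sup>2 / 2 = T r"
      by (simp add: T_def power_mult_distrib)
    then have "(\<rho> r)\<^sup>2 * bernoulli_defect \<rho> u r = 0"
      using flux_fun_of_bernoulli_defect[of \<rho> r u] \<rho>_I(2)[OF that] by simp
    then show ?thesis
      using \<rho>_pos[OF that] by simp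
  qed
  have "euler_solution (Suc q) r0 p rp um \<rho> u"
    unfolding euler_solution_def far_field_and_boundary_def
  proof (intro conjI allI impI sm \<rho>_pos)
    fix r assume r: "r > r0"
    have ev: "\<forall>\<^sub>F s in nhds r. s > r0"
      using r by (intro eventually_nhds_in_open[of "{r0<..}", simplified]) auto
    have "\<forall>\<^sub>F s in nhds r. s ^ q * \<rho> s * u s = r0 ^ q * x0 * um"
      using ev by eventually_elim (use mass in auto)
    then have "((\<lambda>s. s ^ q * \<rho> s * u s) has_real_derivative 0) (at r)"
      by (subst DERIV_cong_ev[OF refl _ refl]) auto
    then show "deriv (\<lambda>s. s ^ (Suc q - 1) * \<rho> s * u s) r = 0"
      by (simp add: DERIV_imp_deriv)
    obtain \<rho>' u' where d: "(\<rho> has_real_derivative \<rho>' r) (at r)" "(u has_real_derivative u' r) (at r)"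
      using smooth_on_atLeast_derivative sm r by metis
    have "\<rho> r > 0"
      using \<rho>_pos r by simp
    have "\<forall>\<^sub>F s in nhds r. bernoulli_defect \<rho> u s = 0"
      using ev by eventually_elim (use defect in auto)
    then have "(bernoulli_defect \<rho> u has_real_derivative 0) (at r)"
      by (subst DERIV_cong_ev[OF refl _ refl]) auto
    \<comment> \<open>Differentiating the vanishing defect recovers the momentum equation up to the
      factor \<open>\<rho> r\<close>.\<close>
    then have "u r * u' r + p' (\<rho> r) / \<rho> r * \<rho>' r = 0"
      using bernoulli_defect_deriv[OF d \<open>\<rho> r > 0\<close>] DERIV_unique by blast
    moreover have "((\<lambda>s. p (\<rho> s)) has_real_derivative p' (\<rho> r) * \<rho>' r) (at r)"
      using DERIV_chain2[OF p_deriv[OF \<open>\<rho> r > 0\<close>] d(1)] .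
    ultimately show "\<rho> r * u r * deriv u r + deriv (\<lambda>s. p (\<rho> s)) r = 0"
      using d \<open>\<rho> r > 0\<close> by (simp add: DERIV_imp_deriv field_simps)
  next
    have inv: "((\<lambda>r :: real. inverse r ^ q) \<longlongrightarrow> 0) at_top"
    proof -
      have "((\<lambda>r :: real. inverse r ^ q) \<longlongrightarrow> 0 ^ q) at_top"
        by (intro tendsto_power tendsto_inverse_0_at_top filterlim_ident)
      moreover have "(0 :: real) ^ q = 0"
        using q by simp
      ultimately show ?thesis
        by simp
    qed
    have "(T \<longlongrightarrow> (r0 ^ q * x0 * um)\<^sup>2 / 2 * 0\<^sup>2) at_top"
      unfolding T_def[abs_def] by (intro tendsto_intros inv)
    then have Tlim: "(T \<longlongrightarrow> 0) at_top"
      by simp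
    have ev: "\<forall>\<^sub>F r in at_top. r \<ge> r0"
      by (rule eventually_ge_at_top)
    have lim: "(\<rho> \<longlongrightarrow> rp) at_top"
    proof -
      \<comment> \<open>Expansiveness of \<open>flux_fun\<close> turns the decay of \<open>T\<close>
        into convergence of the density.\<close>
      have "((\<lambda>r. c * \<bar>\<rho> r - rp\<bar>) \<longlongrightarrow> 0) at_top"
      proof (rule Lim_null_comparison[OF _ Tlim])
        show "\<forall>\<^sub>F r in at_top. norm (c * \<bar>\<rho> r - rp\<bar>) \<le> T r"
          using ev
        proof eventually_elim
          case (elim r)
          have "c * \<bar>\<rho> r - rp\<bar> \<le> \<bar>flux_fun (\<rho> r) - flux_fun rp\<bar>"
            using \<rho>_I(1)[OF elim] I by (intro flux_fun_expansive) auto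
          then show ?case
            using \<rho>_I(2)[OF elim] T_range(1)[OF elim] c by (simp add: abs_mult)
        qed
      qed
      then have "((\<lambda>r. inverse c * (c * \<bar>\<rho> r - rp\<bar>)) \<longlongrightarrow> inverse c * 0) at_top"
        by (intro tendsto_intros)
      then have "((\<lambda>r. \<bar>\<rho> r - rp\<bar>) \<longlongrightarrow> 0) at_top"
        using c by (simp flip: mult.assoc)
      then show ?thesis
        by (simp add: tendsto_rabs_zero_iff LIM_zero_iff)
    qed
    have "(u \<longlongrightarrow> r0 ^ q * x0 * um * 0 * inverse rp) at_top"
      unfolding u_def[abs_def] using rp by (intro tendsto_intros inv lim) auto
    then show "((\<lambda>r. (\<rho> r, u r)) \<longlongrightarrow> (rp, 0)) at_top"
      using lim by (intro tendsto_Pair) auto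
    \<comment> \<open>\<open>x0\<close> and \<open>\<rho> r0\<close> have the same value of
      \<open>flux_fun\<close> and lie in the same neighbourhood, so injectivity identifies them; the
      boundary velocity follows.\<close>
    have "T r0 = (x0 * um)\<^sup>2 / 2"
      using r0 by (simp add: T_def power_mult_distrib field_simps)
    then have "flux_fun x0 = T r0"
      using x0 by (simp add: flux_fun_def power_mult_distrib)
    moreover have "x0 \<in> {rp - \<delta>..rp + \<delta>}" "\<rho> r0 \<in> {rp - \<delta>..rp + \<delta>}"
      using x0(1) \<rho>_I(1)[of r0] I(1) \<delta>(1) by auto
    ultimately have "\<rho> r0 = x0"
      using \<rho>_I(2)[of r0] by (metis flux_fun_inj order_refl)
    then show "u r0 = um"
      using x0_pos r0 by (simp add: u_def field_simps)
  qed
  then show ?thesis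
    using that by blast
qed

text \<open>All densities lie between \<open>rp / 2\<close> and \<open>rp\<close>, so their ratio
  costs at most a factor \<open>2\<close> in the velocity given by mass conservation. The density
  bound is quadratic because the enthalpy deficit is half the squared velocity.\<close>

lemma euler_decay:
  assumes sol: "euler_solution (Suc q) r0 p rp um \<rho> u" and r: "r \<ge> r0"
    and small: "rp\<^sup>2 * um\<^sup>2 < c * \<delta>" "um\<^sup>2 / 2 < c * \<delta>"
  shows "\<bar>\<rho> r - rp\<bar> \<le> (2 * r0 ^ q)\<^sup>2 / (2 * c) * inverse (r ^ (2 * q)) * \<bar>um\<bar>\<^sup>2"
    and "r0 ^ q / 2 * inverse (r ^ q) * \<bar>um\<bar> \<le> \<bar>u r\<bar>"
    and "\<bar>u r\<bar> \<le> 2 * r0 ^ q * inverse (r ^ q) * \<bar>um\<bar>"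
proof -
  have sm: "smooth_on {r0..} \<rho>" "smooth_on {r0..} u"
    and eq: "\<And>r. r > r0 \<Longrightarrow> deriv (\<lambda>s. s ^ q * \<rho> s * u s) r = 0"
    and u0: "u r0 = um"
    using sol by (auto simp: euler_solution_def far_field_and_boundary_def)
  have near: "\<rho> r \<in> {rp - \<delta><..rp}" "\<rho> r0 \<in> {rp - \<delta><..rp}"
    using euler_density_near[OF sol _ small] r by auto
  have pos: "rp / 2 \<le> \<rho> r" "\<rho> r \<le> rp" "rp / 2 \<le> \<rho> r0" "\<rho> r0 \<le> rp" "\<rho> r > 0" "\<rho> r0 > 0" "r > 0"
    using near \<delta> rp r r0 by auto
  have "r ^ q * \<rho> r * u r = r0 ^ q * \<rho> r0 * um"
    using mass_conservation[OF sm eq r] u0 by simp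
  then have "u r = r0 ^ q * inverse (r ^ q) * um * (\<rho> r0 / \<rho> r)"
    using pos by (simp add: field_simps)
  then have u: "\<bar>u r\<bar> = r0 ^ q * inverse (r ^ q) * \<bar>um\<bar> * (\<rho> r0 / \<rho> r)"
    using pos r0 by (simp add: abs_mult)
  have ratio: "1 / 2 \<le> \<rho> r0 / \<rho> r" "\<rho> r0 / \<rho> r \<le> 2"
    using pos by (auto simp: field_simps)
  have nn: "0 \<le> r0 ^ q * inverse (r ^ q) * \<bar>um\<bar>"
    using pos r0 by simp
  show "r0 ^ q / 2 * inverse (r ^ q) * \<bar>um\<bar> \<le> \<bar>u r\<bar>"
    using mult_left_mono[OF ratio(1) nn] u by simp
  show u_le: "\<bar>u r\<bar> \<le> 2 * r0 ^ q * inverse (r ^ q) * \<bar>um\<bar>"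
    using mult_left_mono[OF ratio(2) nn] u by simp
  have "c * \<bar>\<rho> r - rp\<bar> \<le> \<bar>h (\<rho> r) - h rp\<bar>"
    using near \<delta> by (intro h_expansive) auto
  also have "\<dots> = \<bar>u r\<bar>\<^sup>2 / 2"
    using euler_bernoulli[OF sol r] zero_le_power2[of "u r"] by simp
  also have "\<dots> \<le> (2 * r0 ^ q * inverse (r ^ q) * \<bar>um\<bar>)\<^sup>2 / 2"
    using power_mono[OF u_le, of 2] by simp
  finally show "\<bar>\<rho> r - rp\<bar> \<le> (2 * r0 ^ q)\<^sup>2 / (2 * c) * inverse (r ^ (2 * q)) * \<bar>um\<bar>\<^sup>2"
    using c pos by (simp add: field_simps power_mult_distrib power_mult)
qed

section \<open>The Bernoulli defect of a viscous flow\<close>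

text \<open>
  \<open>w\<close> is the divergence \<open>r\<^bsup>-q\<^esup> (r\<^sup>q u)\<^sub>r\<close> and \<open>y = -u\<close>; mass conservation turns the momentum
  equation into the first order equation for \<open>w\<close>. Its coefficient of \<open>w\<close> is positive for
  subsonic flow, so the boundedness of the density selects the slow solution.
\<close>

lemma divergence_bounds:
  fixes \<mu> Y :: real and \<rho> y w :: "real \<Rightarrow> real"
  assumes \<mu>: "\<mu> > 0" and Y: "Y > 0"
    and near: "\<And>r. r > r0 \<Longrightarrow> \<rho> r \<in> {rp - \<delta>..rp + \<delta>}"
    and y: "\<And>r. r > r0 \<Longrightarrow> 0 < y r" "\<And>r. r > r0 \<Longrightarrow> y r \<le> Y / r ^ q"
    and subsonic: "\<And>r. r > r0 \<Longrightarrow> (y r)\<^sup>2 \<le> c / 2"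
    and \<rho>: "\<And>r. r > r0 \<Longrightarrow> (\<rho> has_real_derivative \<rho> r * w r / y r) (at r)"
    and w: "\<And>r. r > r0 \<Longrightarrow> (w has_real_derivative
      (\<rho> r * (p' (\<rho> r) / y r - y r) * w r - real q * \<rho> r * (y r)\<^sup>2 / r) / \<mu>) (at r)"
    and r: "r > r0"
  shows "0 \<le> w r" "w r \<le> 2 * real q * Y ^ 3 / (c * r ^ (3 * q + 1))"
proof -
  \<comment> \<open>The equation becomes \<open>\<mu> * w' = a * w - b\<close>, and
    \<open>\<beta>\<close> is a decreasing majorant of \<open>b / a\<close>.\<close>
  define a where "a r = \<rho> r * (p' (\<rho> r) / y r - y r)" for r
  define b where "b r = real q * \<rho> r * (y r)\<^sup>2 / r" for r
  define \<beta> where "\<beta> r = 2 * real q * Y ^ 3 / (c * r ^ (3 * q + 1))" for r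
  have \<rho>_bounds: "\<rho> s > 0" "rp / 2 \<le> \<rho> s" "\<bar>\<rho> s\<bar> \<le> 3 / 2 * rp" if "s > r0" for s
    using near_bounds[OF near[OF that]] by auto
  have y_le: "y s \<le> Y / r0 ^ q" if "s > r0" for s
  proof -
    have "Y / s ^ q \<le> Y / r0 ^ q"
      using that r0 Y by (intro divide_left_mono power_mono mult_pos_pos) auto
    then show ?thesis
      using y(2)[OF that] by linarith
  qed
  have b_nonneg: "b s \<ge> 0" if "s > r0" for s
    using that \<rho>_bounds[OF that] r0 by (simp add: b_def)
  \<comment> \<open>The subsonic bound takes at most half of the lower bound \<open>c\<close> for
    the derivative of the pressure.\<close>
  have a_ge: "\<rho> s * c / (2 * y s) \<le> a s" if s: "s > r0" for s
  proof -
    have "c / 2 \<le> p' (\<rho> s) - (y s)\<^sup>2"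
      using subsonic[OF s] c_le_p'[OF near[OF s]] by simp
    then have "(c / 2) / y s \<le> (p' (\<rho> s) - (y s)\<^sup>2) / y s"
      using y(1)[OF s] by (intro divide_right_mono) auto
    also have "\<dots> = p' (\<rho> s) / y s - y s"
      using y(1)[OF s] by (simp add: field_simps power2_eq_square)
    finally have "\<rho> s * ((c / 2) / y s) \<le> a s"
      unfolding a_def using \<rho>_bounds(1)[OF s] by (intro mult_left_mono) auto
    then show ?thesis
      by simp
  qed
  have a_pos: "a s > 0" if s: "s > r0" for s
    using order_less_le_trans[OF _ a_ge[OF s]] \<rho>_bounds(1)[OF s] y(1)[OF s] c by simp
  have b_le: "b s \<le> a s * \<beta> s" if s: "s > r0" for s
  proof -
    have s0: "s > 0"
      using s r0 by simp
    \<comment> \<open>\<open>b * y\<close> contains \<open>y ^ 3\<close>, and this bound on the cube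
      produces the rate of \<open>\<beta>\<close>.\<close>
    have "(y s * s ^ q) ^ 3 \<le> Y ^ 3"
      using y[OF s] s0 by (intro power_mono) (auto simp: field_simps)
    then have "y s ^ 3 * s ^ (3 * q) \<le> Y ^ 3"
      by (simp add: power_mult_distrib power_mult mult.commute[of 3])
    then have "real q * \<rho> s * (y s ^ 3 * s ^ (3 * q)) / (y s * s ^ (3 * q + 1))
        \<le> real q * \<rho> s * Y ^ 3 / (y s * s ^ (3 * q + 1))"
      using \<rho>_bounds(1)[OF s] y(1)[OF s] s0 by (intro divide_right_mono mult_left_mono) auto
    also have "real q * \<rho> s * (y s ^ 3 * s ^ (3 * q)) / (y s * s ^ (3 * q + 1)) = b s"
      using y(1)[OF s] s0 by (simp add: b_def field_simps power2_eq_square power3_eq_cube)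
    also have "real q * \<rho> s * Y ^ 3 / (y s * s ^ (3 * q + 1)) = \<rho> s * c / (2 * y s) * \<beta> s"
      using y(1)[OF s] s0 c by (simp add: \<beta>_def field_simps)
    also have "\<dots> \<le> a s * \<beta> s"
      using a_ge[OF s] s0 Y c by (intro mult_right_mono) (auto simp: \<beta>_def)
    finally show ?thesis .
  qed
  have \<beta>_mono: "\<beta> s \<le> \<beta> r" if "s \<ge> r" for s
    unfolding \<beta>_def using that r r0 c Y
    by (intro divide_left_mono mult_left_mono power_mono mult_pos_pos zero_less_power) auto
  have \<beta>_pos: "\<beta> r \<ge> 0"
    unfolding \<beta>_def using r r0 c Y by simp
  \<comment> \<open>The density has derivative \<open>\<rho> * w / y\<close>, so a \<open>w\<close>
    of one sign and bounded away from zero would drive it out of its bounded range.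
    \<open>\<sigma>\<close> is that sign.\<close>
  have no_drift: False if e: "e > 0" and \<sigma>: "\<sigma> = 1 \<or> \<sigma> = - 1"
    and drift: "\<And>s. s \<ge> r \<Longrightarrow> e \<le> \<sigma> * w s" for e \<sigma>
  proof (rule unbounded_of_derivative_ge)
    fix s assume s: "s \<ge> r"
    then have s': "s > r0"
      using r by simp
    show "((\<lambda>s. \<sigma> * \<rho> s) has_real_derivative \<sigma> * (\<rho> s * w s / y s)) (at s)"
      by (rule DERIV_cmult[OF \<rho>[OF s']])
    have "rp / 2 * e / (Y / r0 ^ q) \<le> \<rho> s * (\<sigma> * w s) / y s"
      using \<rho>_bounds[OF s'] drift[OF s] y(1)[OF s'] y_le[OF s'] e rp
      by (intro frac_le mult_mono) auto
    then show "rp / 2 * e / (Y / r0 ^ q) \<le> \<sigma> * (\<rho> s * w s / y s)"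
      by (simp add: mult_ac)
    show "\<bar>\<sigma> * \<rho> s\<bar> \<le> 3 / 2 * rp"
      using \<sigma> \<rho>_bounds(3)[OF s'] by auto
  qed (use rp e Y r0 in auto)
  have w': "(w has_real_derivative (a s * w s - b s) / \<mu>) (at s)" if "s \<ge> r" for s
    using w[of s] that r by (simp add: a_def b_def)
  show "0 \<le> w r"
  proof (rule ccontr)
    assume neg: "\<not> 0 \<le> w r"
    \<comment> \<open>Where \<open>w\<close> is negative, so is \<open>a * w - b\<close>; once
      negative, \<open>w\<close> cannot rise again.\<close>
    have "- w r \<le> - w s" if "s \<ge> r" for s
    proof (rule stays_above_threshold[of r "\<lambda>s. - w s"])
      fix t assume t: "t \<ge> r"
      show "((\<lambda>s. - w s) has_real_derivative - ((a t * w t - b t) / \<mu>)) (at t)"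
        by (rule DERIV_minus[OF w'[OF t]])
      assume "- w r \<le> - w t"
      then have "a t * w t < 0"
        using neg a_pos[of t] t r by (intro mult_pos_neg) auto
      then show "0 < - ((a t * w t - b t) / \<mu>)"
        using b_nonneg[of t] t r \<mu> by (simp add: field_simps)
    qed (use that in auto)
    then show False
      using neg no_drift[of "- w r" "- 1"] by simp
  qed
  have "w r \<le> \<beta> r"
  proof (rule ccontr)
    assume gt: "\<not> w r \<le> \<beta> r"
    \<comment> \<open>A value above \<open>\<beta> r\<close> is above every later value of
      \<open>\<beta>\<close>, so \<open>a * w - b\<close> stays positive and \<open>w\<close> never
      comes back down.\<close>
    have "w r \<le> w s" if "s \<ge> r" for s
    proof (rule stays_above_threshold[of r w])
      fix t assume t: "t \<ge> r"
      show "(w has_real_derivative ((a t * w t - b t) / \<mu>)) (at t)"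
        by (rule w'[OF t])
      assume "w r \<le> w t"
      then have "a t * \<beta> t < a t * w t"
        using gt a_pos[of t] t r \<beta>_mono[OF t] by (intro mult_strict_left_mono) auto
      then show "0 < (a t * w t - b t) / \<mu>"
        using b_le[of t] t r \<mu> by (simp add: field_simps)
    qed (use that in auto)
    then show False
      using gt \<beta>_pos no_drift[of "w r" 1] by simp
  qed
  then show "w r \<le> 2 * real q * Y ^ 3 / (c * r ^ (3 * q + 1))"
    by (simp add: \<beta>_def)
qed

text \<open>Mass conservation reads \<open>\<rho> * w + \<rho>' * u = 0\<close>, so the derivatives
  of density and velocity are both expressed through \<open>w\<close>. The momentum equation then
  becomes first order and affine in \<open>w\<close>.\<close>

lemma navier_stokes_divergence_form:
  fixes \<rho> u :: "real \<Rightarrow> real"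
  assumes sol: "navier_stokes_solution (Suc q) r0 p rp um \<mu> \<rho> u" and um: "um < 0"
  obtains w where
    "\<And>r. r \<ge> r0 \<Longrightarrow> u r < 0"
    "\<And>r. r > r0 \<Longrightarrow> (\<rho> has_real_derivative \<rho> r * w r / (- u r)) (at r)"
    "\<And>r. r > r0 \<Longrightarrow> (u has_real_derivative w r - real q * u r / r) (at r)"
    "\<And>r. r > r0 \<Longrightarrow> \<exists>w'. (w has_real_derivative w') (at r) \<and>
       \<mu> * w' = \<rho> r * (p' (\<rho> r) / (- u r) - (- u r)) * w r - real q * \<rho> r * (- u r)\<^sup>2 / r"
proof -
  have sm: "smooth_on {r0..} \<rho>" "smooth_on {r0..} u" and pos: "\<And>r. r \<ge> r0 \<Longrightarrow> \<rho> r > 0"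
    and mass: "\<And>r. r > r0 \<Longrightarrow> deriv (\<lambda>s. s ^ q * \<rho> s * u s) r = 0"
    and mom: "\<And>r. r > r0 \<Longrightarrow> \<rho> r * u r * deriv u r + deriv (\<lambda>s. p (\<rho> s)) r =
        \<mu> * deriv (\<lambda>s. deriv (\<lambda>t. t ^ q * u t) s / s ^ q) r"
    and u0: "u r0 = um"
    using sol by (auto simp: navier_stokes_solution_def far_field_and_boundary_def)
  obtain \<rho>' where \<rho>': "\<And>r. r > r0 \<Longrightarrow> (\<rho> has_real_derivative \<rho>' r) (at r)"
    using smooth_on_atLeast_derivative[OF sm(1)] by metis
  obtain u' where u'_sm: "smooth_on {r0..} u'"
    and u': "\<And>r. r > r0 \<Longrightarrow> (u has_real_derivative u' r) (at r)"
    using smooth_on_atLeast_derivative[OF sm(2)] by metis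
  obtain u'' where u'': "\<And>r. r > r0 \<Longrightarrow> (u' has_real_derivative u'' r) (at r)"
    using smooth_on_atLeast_derivative[OF u'_sm] by metis
  define w where "w r = u' r + real q * u r / r" for r
  have u_neg: "u r < 0" if "r \<ge> r0" for r
  proof -
    have "r ^ q * \<rho> r * u r < 0"
      using mass_conservation[OF sm mass that] u0 um pos[of r0] r0 by (simp add: mult_pos_neg)
    moreover have "r ^ q * \<rho> r > 0"
      using that r0 pos[OF that] by simp
    ultimately show ?thesis
      by (metis mult_less_0_iff order_less_asym)
  qed
  \<comment> \<open>Removing the exponent \<open>q - 1\<close> exposes the common factor
    \<open>r ^ q\<close> to be cancelled.\<close>
  have pw: "real q * r ^ (q - 1) = real q * r ^ q / r" if "r > 0" for r :: real
    using that q by (cases q) auto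
  have u'_eq: "u' r = w r - real q * u r / r" for r
    by (simp add: w_def)
  have \<rho>'_eq: "\<rho>' r = \<rho> r * w r / (- u r)" if r: "r > r0" for r
  proof -
    have r_pos: "r > 0" "r ^ q > 0" and "u r < 0"
      using r r0 u_neg by auto
    have "((\<lambda>s. s ^ q * \<rho> s * u s) has_real_derivative
        (real q * r ^ (q - 1) * \<rho> r + \<rho>' r * r ^ q) * u r + u' r * (r ^ q * \<rho> r)) (at r)"
      using DERIV_mult[OF DERIV_mult[OF DERIV_pow \<rho>'[OF r]] u'[OF r], of q] by simp
    from DERIV_imp_deriv[OF this]
    have "(real q * r ^ (q - 1) * \<rho> r + \<rho>' r * r ^ q) * u r + u' r * (r ^ q * \<rho> r) = 0"
      using mass[OF r] by simp
    then have "r ^ q * (\<rho> r * w r + \<rho>' r * u r) = 0"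
      unfolding pw[OF r_pos(1)] w_def by (simp add: algebra_simps)
    then have "\<rho> r * w r + \<rho>' r * u r = 0"
      using r_pos(2) by (metis less_irrefl mult_eq_0_iff)
    then show ?thesis
      using \<open>u r < 0\<close> by (simp add: field_simps)
  qed
  show ?thesis
  proof (rule that[of w])
    fix r assume r: "r > r0"
    have r_pos: "r > 0" and u_r: "u r < 0" and \<rho>_r: "\<rho> r > 0"
      using r r0 u_neg pos by auto
    show "(\<rho> has_real_derivative \<rho> r * w r / (- u r)) (at r)"
      using \<rho>'[OF r] \<rho>'_eq[OF r] by simp
    show "(u has_real_derivative w r - real q * u r / r) (at r)"
      using u'[OF r] u'_eq by simp
    define w' where "w' = u'' r + (real q * u' r * r - real q * u r) / (r * r)"
    have w': "(w has_real_derivative w') (at r)"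
      unfolding w_def[abs_def] w'_def using u'[OF r] u''[OF r] r_pos
      by (auto intro!: derivative_eq_intros)
    have div: "deriv (\<lambda>t. t ^ q * u t) s / s ^ q = w s" if s: "s > r0" for s
    proof -
      have "((\<lambda>t. t ^ q * u t) has_real_derivative real q * s ^ (q - 1) * u s + u' s * s ^ q) (at s)"
        using DERIV_mult[OF DERIV_pow u'[OF s], of q] by simp
      moreover have "s > 0"
        using s r0 by simp
      moreover have "(real q * s ^ (q - 1) * u s + u' s * s ^ q) / s ^ q = w s"
        unfolding pw[OF \<open>s > 0\<close>] w_def using \<open>s > 0\<close> by (simp add: field_simps)
      ultimately show ?thesis
        by (simp add: DERIV_imp_deriv)
    qed
    have "\<forall>\<^sub>F s in nhds r. s > r0"
      using r by (intro eventually_nhds_in_open[of "{r0<..}", simplified]) auto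
    then have "deriv (\<lambda>s. deriv (\<lambda>t. t ^ q * u t) s / s ^ q) r = deriv w r"
      by (intro deriv_cong_ev) (auto elim!: eventually_mono simp: div)
    then have "\<mu> * w' = \<rho> r * u r * u' r + p' (\<rho> r) * \<rho>' r"
      using mom[OF r] w' u'[OF r] DERIV_chain2[OF p_deriv[OF \<rho>_r] \<rho>'[OF r]]
      by (simp add: DERIV_imp_deriv)
    also have "\<dots> = \<rho> r * (p' (\<rho> r) / (- u r) - (- u r)) * w r - real q * \<rho> r * (- u r)\<^sup>2 / r"
      unfolding \<rho>'_eq[OF r] u'_eq using u_r r_pos
      by (simp add: field_simps power2_eq_square)
    finally show "\<exists>w'. (w has_real_derivative w') (at r) \<and>
        \<mu> * w' = \<rho> r * (p' (\<rho> r) / (- u r) - (- u r)) * w r - real q * \<rho> r * (- u r)\<^sup>2 / r"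
      using w' by blast
  qed (use u_neg in auto)
qed

text \<open>Two contributions per unit of \<mu>, with \<open>\<bar>um\<bar> \<le> 1\<close>
  absorbed: the integral of \<open>w\<^sup>2 / (\<rho> * y)\<close> from infinity, where
  \<open>y = - u\<close>, and the bound for \<open>w / \<rho>\<close>.\<close>

definition defect_const :: "real \<Rightarrow> real" where
  "defect_const K = 8 * (real q)\<^sup>2 * K ^ 7 / (c\<^sup>2 * rp * r0 ^ (5 * q)) / r0 + 4 * real q * K ^ 3 / (rp * c * r0 ^ (3 * q + 1))"

text \<open>The momentum equation divided by \<rho> gives the defect the derivative
  \<open>\<mu> * w' / \<rho>\<close>, but the bounds at hand are for \<open>w\<close>, not
  \<open>w'\<close>. Integration by parts helps: after subtracting \<open>\<mu> * w / \<rho>\<close>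
  the derivative is \<open>\<mu> * w\<^sup>2 / (\<rho> * y)\<close> with \<open>y = - u\<close>,
  which is integrable up to infinity.\<close>

lemma bernoulli_defect_bound:
  fixes \<rho> u :: "real \<Rightarrow> real"
  assumes sol: "navier_stokes_solution (Suc q) r0 p rp um \<mu> \<rho> u"
    and decay: "decay_estimates (Suc q) r0 rp um K \<rho> u"
    and \<mu>: "\<mu> > 0" and K: "K > 0" and um: "um < 0" "\<bar>um\<bar> \<le> 1"
    and subsonic: "K\<^sup>2 * um\<^sup>2 \<le> c / 2 * (r0 ^ q)\<^sup>2"
    and near: "\<And>r. r \<ge> r0 \<Longrightarrow> \<rho> r \<in> {rp - \<delta>..rp + \<delta>}" and r: "r \<ge> r0"
  shows "\<bar>bernoulli_defect \<rho> u r\<bar> \<le> defect_const K * \<mu>"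
proof -
  have sm: "smooth_on {r0..} \<rho>" "smooth_on {r0..} u" and pos: "\<And>r. r \<ge> r0 \<Longrightarrow> \<rho> r > 0"
    and ff: "far_field_and_boundary r0 rp um \<rho> u"
    using sol by (auto simp: navier_stokes_solution_def)
  obtain w where u_neg: "\<And>r. r \<ge> r0 \<Longrightarrow> u r < 0"
    and \<rho>': "\<And>r. r > r0 \<Longrightarrow> (\<rho> has_real_derivative \<rho> r * w r / (- u r)) (at r)"
    and u': "\<And>r. r > r0 \<Longrightarrow> (u has_real_derivative w r - real q * u r / r) (at r)"
    and w_ex: "\<And>r. r > r0 \<Longrightarrow> \<exists>w'. (w has_real_derivative w') (at r) \<and>
       \<mu> * w' = \<rho> r * (p' (\<rho> r) / (- u r) - (- u r)) * w r - real q * \<rho> r * (- u r)\<^sup>2 / r"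
    using navier_stokes_divergence_form[OF sol um(1)] by metis
  define W where "W r = (\<rho> r * (p' (\<rho> r) / (- u r) - (- u r)) * w r - real q * \<rho> r * (- u r)\<^sup>2 / r) / \<mu>" for r
  have W: "(w has_real_derivative W r) (at r)" if "r > r0" for r
    using w_ex[OF that] \<mu> by (metis W_def nonzero_mult_div_cancel_left less_numeral_extra(3))
  define Y where "Y = K * \<bar>um\<bar>"
  have Y: "Y > 0" "Y \<le> K"
    using K um mult_left_mono[OF um(2), of K] by (auto simp: Y_def mult_pos_neg)
  have y_le: "- u s \<le> Y / s ^ q" if "s \<ge> r0" for s
    using decay that by (auto simp: decay_estimates_def Y_def divide_inverse mult_ac)
  have y_ge: "\<bar>um\<bar> / (K * s ^ q) \<le> - u s" if "s \<ge> r0" for s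
    using decay that u_neg[OF that] by (auto simp: decay_estimates_def divide_inverse mult_ac)
  have y_sub: "(- u s)\<^sup>2 \<le> c / 2" if s: "s \<ge> r0" for s
  proof -
    have "- u s \<le> Y / r0 ^ q"
      using y_le[OF s] divide_left_mono[of "r0 ^ q" "s ^ q" Y] power_mono[OF s, of q] s r0 Y by auto
    then have "(- u s)\<^sup>2 \<le> (Y / r0 ^ q)\<^sup>2"
      using u_neg[OF s] by (intro power_mono) auto
    also have "\<dots> = K\<^sup>2 * um\<^sup>2 / (r0 ^ q)\<^sup>2"
      by (simp add: Y_def power_mult_distrib power_divide)
    also have "\<dots> \<le> c / 2"
      using subsonic r0 by (simp add: pos_divide_le_eq)
    finally show ?thesis .
  qed
  define \<beta> where "\<beta> r = 2 * real q * Y ^ 3 / (c * r ^ (3 * q + 1))" for r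
  have w_bounds: "0 \<le> w s" "w s \<le> \<beta> s" if s: "s > r0" for s
    unfolding \<beta>_def
    by (rule divergence_bounds[of \<mu> Y \<rho> "\<lambda>s. - u s" w s];
        use \<mu> Y near u_neg y_le y_sub \<rho>' W s in \<open>auto simp: W_def\<close>)+
  define F where "F r = bernoulli_defect \<rho> u r - \<mu> * w r / \<rho> r" for r
  define k where "k = \<mu> * (8 * (real q)\<^sup>2 * K ^ 7 / (c\<^sup>2 * rp * r0 ^ (5 * q)))"
  have F: "(F has_real_derivative \<mu> * (w s)\<^sup>2 / (\<rho> s * (- u s))) (at s)" if s: "s > r0" for s
  proof -
    have \<rho>_s: "\<rho> s > 0" and u_s: "u s < 0" and s0: "s > 0"
      using s pos u_neg r0 by auto
    have "(F has_real_derivative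
        (u s * (w s - real q * u s / s) + p' (\<rho> s) / \<rho> s * (\<rho> s * w s / (- u s)))
        - (\<mu> * W s * \<rho> s - \<mu> * w s * (\<rho> s * w s / (- u s))) / (\<rho> s * \<rho> s)) (at s)"
      unfolding F_def[abs_def]
      using DERIV_diff[OF bernoulli_defect_deriv[OF \<rho>'[OF s] u'[OF s] \<rho>_s]
          DERIV_divide[OF DERIV_cmult[OF W[OF s], of \<mu>] \<rho>'[OF s]]] \<rho>_s by simp
    moreover have "\<mu> * W s = \<rho> s * (p' (\<rho> s) / (- u s) - (- u s)) * w s - real q * \<rho> s * (- u s)\<^sup>2 / s"
      using \<mu> by (simp add: W_def)
    ultimately show ?thesis
      using \<rho>_s u_s s0 by (simp add: field_simps power2_eq_square)
  qed
  have F'_nonneg: "0 \<le> \<mu> * (w s)\<^sup>2 / (\<rho> s * (- u s))" if s: "s > r0" for s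
    using pos[of s] u_neg[of s] s \<mu> by (intro divide_nonneg_nonneg mult_nonneg_nonneg) auto
  \<comment> \<open>Dividing by the velocity is harmless: \<open>\<beta>\<^sup>2\<close> carries
    \<open>\<bar>um\<bar> ^ 6\<close> and the lower decay bound costs one factor, leaving
    \<open>\<bar>um\<bar> ^ 5\<close>.\<close>
  have F'_le: "\<mu> * (w s)\<^sup>2 / (\<rho> s * (- u s)) \<le> k / s\<^sup>2" if s: "s > r0" for s
  proof -
    have s0: "s > 0" and \<rho>_s: "rp / 2 \<le> \<rho> s"
      using s r0 near_bounds[OF near[of s]] by auto
    have "0 < \<bar>um\<bar> / (K * s ^ q)"
      using um K s0 by (intro divide_pos_pos mult_pos_pos zero_less_power) auto
    moreover have "\<bar>um\<bar> / (K * s ^ q) \<le> - u s"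
      using y_ge s by simp
    moreover have "(w s)\<^sup>2 \<le> (\<beta> s)\<^sup>2"
      using w_bounds[OF s] by (simp add: power_mono)
    ultimately have "\<mu> * (w s)\<^sup>2 / (\<rho> s * (- u s)) \<le> \<mu> * (\<beta> s)\<^sup>2 / (rp / 2 * (\<bar>um\<bar> / (K * s ^ q)))"
      using \<mu> \<rho>_s rp
      by (intro frac_le mult_left_mono mult_pos_pos mult_mono[of "rp / 2" "\<rho> s"]) auto
    also have "\<dots> = \<mu> * (8 * (real q)\<^sup>2 * K ^ 7 / (c\<^sup>2 * rp)) * \<bar>um\<bar> ^ 5 / (s ^ (5 * q) * s\<^sup>2)"
    proof -
      have "(\<beta> s)\<^sup>2 = 4 * (real q)\<^sup>2 * (K ^ 6 * \<bar>um\<bar> ^ 6) / (c\<^sup>2 * (s ^ q * s ^ (5 * q) * s\<^sup>2))"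
        by (simp add: \<beta>_def Y_def power_divide power_mult_distrib flip: power_mult power_add)
      moreover have "K ^ 7 = K ^ 6 * K" "\<bar>um\<bar> ^ 6 = \<bar>um\<bar> ^ 5 * \<bar>um\<bar>"
        by (simp_all flip: power_Suc2)
      ultimately show ?thesis
        using um K s0 rp c by (simp add: field_simps)
    qed
    \<comment> \<open>The factor \<open>s\<^sup>2\<close> is kept for integrability;
      \<open>s ^ (5 * q)\<close> is traded for its value at \<open>r0\<close>.\<close>
    also have "\<dots> \<le> \<mu> * (8 * (real q)\<^sup>2 * K ^ 7 / (c\<^sup>2 * rp)) * 1 / (r0 ^ (5 * q) * s\<^sup>2)"
      using um K s0 rp c \<mu> s r0
      by (intro frac_le mult_left_mono mult_right_mono power_mono power_le_one) auto
    also have "\<dots> = k / s\<^sup>2"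
      by (simp add: k_def)
    finally show ?thesis .
  qed
  have k_nonneg: "k \<ge> 0"
    using \<mu> K c rp r0 by (simp add: k_def)
  have \<beta>_le: "\<beta> s \<le> 2 * real q * K ^ 3 / (c * r0 ^ (3 * q + 1))" if "s > r0" for s
    unfolding \<beta>_def using that Y K r0 c
    by (intro frac_le mult_left_mono power_mono mult_pos_pos zero_less_power) auto
  have wdiv: "0 \<le> \<mu> * w s / \<rho> s" "\<mu> * w s / \<rho> s \<le> \<mu> * \<beta> s / (rp / 2)" if s: "s > r0" for s
  proof -
    have "0 \<le> \<mu> * w s" "\<mu> * w s \<le> \<mu> * \<beta> s" "rp / 2 \<le> \<rho> s"
      using w_bounds[OF s] \<mu> near_bounds[OF near[of s]] s by (auto intro: mult_left_mono)
    then show "0 \<le> \<mu> * w s / \<rho> s" "\<mu> * w s / \<rho> s \<le> \<mu> * \<beta> s / (rp / 2)"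
      using rp frac_le[of "\<mu> * \<beta> s" "\<mu> * w s" "rp / 2" "\<rho> s"] by auto
  qed
  have \<beta>_lim: "(\<beta> \<longlongrightarrow> 0) at_top"
  proof -
    have "((\<lambda>r. 2 * real q * Y ^ 3 / c * inverse r ^ (3 * q + 1)) \<longlongrightarrow> 2 * real q * Y ^ 3 / c * 0 ^ (3 * q + 1)) at_top"
      by (intro tendsto_intros tendsto_inverse_0_at_top filterlim_ident)
    then show ?thesis
      by (simp add: \<beta>_def[abs_def] field_simps)
  qed
  have "((\<lambda>s. \<mu> * w s / \<rho> s) \<longlongrightarrow> 0) at_top"
  proof (rule Lim_null_comparison)
    show "\<forall>\<^sub>F s in at_top. norm (\<mu> * w s / \<rho> s) \<le> \<mu> * \<beta> s / (rp / 2)"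
      using eventually_gt_at_top[of r0] by eventually_elim (simp only: real_norm_def abs_of_nonneg[OF wdiv(1)] wdiv(2))
    have "((\<lambda>s. \<mu> * \<beta> s / (rp / 2)) \<longlongrightarrow> \<mu> * 0 / (rp / 2)) at_top"
      using rp by (intro tendsto_intros \<beta>_lim) auto
    then show "((\<lambda>s. \<mu> * \<beta> s / (rp / 2)) \<longlongrightarrow> 0) at_top"
      by simp
  qed
  then have "(F \<longlongrightarrow> 0 - 0) at_top"
    unfolding F_def[abs_def] by (intro tendsto_diff bernoulli_defect_tendsto[OF ff])
  then have F_lim: "(F \<longlongrightarrow> 0) at_top"
    by simp
  have main: "\<bar>bernoulli_defect \<rho> u s\<bar> \<le> defect_const K * \<mu>" if s: "s > r0" for s
  proof -
    have "- (k / s) \<le> F s" "F s \<le> 0"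
      using bounds_of_decaying_antiderivative[OF r0 F F'_nonneg F'_le F_lim s] by auto
    moreover have "k / s \<le> k / r0"
      using s r0 k_nonneg by (intro divide_left_mono) auto
    moreover have "\<mu> * w s / \<rho> s \<le> \<mu> * (2 * real q * K ^ 3 / (c * r0 ^ (3 * q + 1))) / (rp / 2)"
      using wdiv(2)[OF s] \<beta>_le[OF s] \<mu> rp
      by (elim order_trans) (intro divide_right_mono mult_left_mono; simp)
    moreover have "k / r0 + \<mu> * (2 * real q * K ^ 3 / (c * r0 ^ (3 * q + 1))) / (rp / 2) = defect_const K * \<mu>"
      by (simp add: k_def defect_const_def algebra_simps)
    moreover have "0 \<le> k / r0"
      using k_nonneg r0 by simp
    ultimately show ?thesis
      using wdiv(1)[OF s] by (simp add: F_def)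
  qed
  \<comment> \<open>The equations hold only beyond \<open>r0\<close>; the boundary point is reached
    by continuity.\<close>
  show ?thesis
  proof (cases "r = r0")
    case True
    have "(bernoulli_defect \<rho> u \<longlongrightarrow> bernoulli_defect \<rho> u r0) (at_right r0)"
      using bernoulli_defect_continuous_on[OF sm pos]
      by (metis at_within_Ici_at_right atLeast_iff continuous_on_def order_refl)
    then have "((\<lambda>s. \<bar>bernoulli_defect \<rho> u s\<bar>) \<longlongrightarrow> \<bar>bernoulli_defect \<rho> u r0\<bar>) (at_right r0)"
      by (rule tendsto_rabs)
    then show ?thesis
      unfolding True
      by (rule tendsto_upperbound) (auto simp: main eventually_at_right_less
          intro!: eventually_mono[OF eventually_at_right_less[of r0]])
  qed (use main r in auto)
qed

section \<open>Vanishing viscosity\<close>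

text \<open>\<open>B\<close> bounds the defect per unit of \<mu>. The first summand carries the
  boundary density error \<open>B / c\<close> through the mass flux, the second bounds
  \<open>\<rho>\<^sup>2\<close> times the defect, and the final division by \<open>c\<close> inverts
  \<open>flux_fun\<close>.\<close>

definition density_const :: "real \<Rightarrow> real" where
  "density_const B = (3 * rp / (2 * c) + 9 / 4 * rp\<^sup>2) * B / c"

text \<open>\<open>B / c\<close> and \<open>density_const B\<close> account for the density errors
  at \<open>r0\<close> and at \<open>r\<close>; the denominator bounds the product of the two
  densities from below.\<close>

definition velocity_const :: "real \<Rightarrow> real" where
  "velocity_const B = (3 / 2 * rp) * (B / c + density_const B) / (rp / 2)\<^sup>2"

text \<open>Viscosity enters only through the defect bound. Equal boundary velocities make the
  boundary densities, hence the mass fluxes, close; expansiveness of \<open>flux_fun\<close> carries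
  this to the density at \<open>r\<close>, and the velocity is flux over density.\<close>

lemma euler_stability:
  fixes \<rho> u :: "real \<Rightarrow> real"
  assumes euler: "euler_solution (Suc q) r0 p rp um \<rho>E uE"
    and small: "rp\<^sup>2 * um\<^sup>2 < c * \<delta>" "um\<^sup>2 / 2 < c * \<delta>" "\<bar>um\<bar> \<le> 1"
    and mass: "\<And>r. r \<ge> r0 \<Longrightarrow> r ^ q * \<rho> r * u r = r0 ^ q * \<rho> r0 * u r0" and u0: "u r0 = um"
    and near: "\<And>r. r \<ge> r0 \<Longrightarrow> \<rho> r \<in> {rp - \<delta>..rp + \<delta>}"
    and defect: "\<And>r. r \<ge> r0 \<Longrightarrow> \<bar>bernoulli_defect \<rho> u r\<bar> \<le> B * \<mu>"
    and r: "r \<ge> r0"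
  shows "\<bar>\<rho> r - \<rho>E r\<bar> \<le> density_const B * \<mu>" "\<bar>u r - uE r\<bar> \<le> velocity_const B * \<mu>"
proof -
  have smE: "smooth_on {r0..} \<rho>E" "smooth_on {r0..} uE"
    and eqE: "\<And>r. r > r0 \<Longrightarrow> deriv (\<lambda>s. s ^ q * \<rho>E s * uE s) r = 0" and uE0: "uE r0 = um"
    using euler by (auto simp: euler_solution_def far_field_and_boundary_def)
  have nearE: "\<rho>E s \<in> {rp - \<delta>..rp + \<delta>}" if "s \<ge> r0" for s
    using euler_density_near[OF euler that small(1,2)] \<delta>(1) by auto
  note bds = near_bounds[OF near[OF r]] near_bounds[OF nearE[OF r]]
    near_bounds[OF near[OF order_refl]] near_bounds[OF nearE[OF order_refl]]
  define t where "t = B * \<mu>"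
  \<comment> \<open>Both velocities equal \<open>um\<close> at \<open>r0\<close>, so the enthalpy
    difference there is exactly the defect.\<close>
  have "c * \<bar>\<rho> r0 - \<rho>E r0\<bar> \<le> \<bar>h (\<rho> r0) - h (\<rho>E r0)\<bar>"
    by (intro h_expansive near nearE order_refl)
  also have "\<dots> = \<bar>bernoulli_defect \<rho> u r0\<bar>"
    using euler_bernoulli[OF euler order_refl] unfolding bernoulli_defect_def u0 uE0 by linarith
  also have "\<dots> \<le> t"
    using defect[of r0] by (simp add: t_def)
  finally have d0: "\<bar>\<rho> r0 - \<rho>E r0\<bar> \<le> t / c"
    using c by (simp add: field_simps)
  then have t_nonneg: "t \<ge> 0"
    using c by (simp add: field_simps) (smt (verit) mult_nonneg_nonneg)
  \<comment> \<open>Geometric dilution factor, common to both mass fluxes.\<close>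
  define \<theta> where "\<theta> = (r0 / r) ^ q"
  have r_pos: "r > 0"
    using r r0 by simp
  have \<theta>: "0 \<le> \<theta>" "\<theta> \<le> 1"
    unfolding \<theta>_def using r r0 by (auto intro: power_le_one)
  have flux: "\<rho> r * u r = \<theta> * um * \<rho> r0"
    using mass[OF r] u0 r_pos by (simp add: \<theta>_def power_divide field_simps)
  have fluxE: "\<rho>E r * uE r = \<theta> * um * \<rho>E r0"
    using mass_conservation[OF smE eqE r] uE0 r_pos by (simp add: \<theta>_def power_divide field_simps)
  have \<theta>um: "\<bar>\<theta> * um\<bar> \<le> 1"
    using \<theta> small(3) mult_le_one[of \<theta> "\<bar>um\<bar>"] by (simp add: abs_mult)
  have "flux_fun (\<rho> r) - flux_fun (\<rho>E r)
      = (\<theta> * um)\<^sup>2 / 2 * ((\<rho> r0 - \<rho>E r0) * (\<rho> r0 + \<rho>E r0)) - (\<rho> r)\<^sup>2 * bernoulli_defect \<rho> u r"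
  proof -
    have "bernoulli_defect \<rho>E uE r = 0"
      using euler_bernoulli[OF euler r] unfolding bernoulli_defect_def by linarith
    then show ?thesis
      unfolding flux_fun_of_bernoulli_defect[of \<rho> r u] flux_fun_of_bernoulli_defect[of \<rho>E r uE] flux fluxE
      by (simp add: power_mult_distrib power2_eq_square algebra_simps diff_divide_distrib)
  qed
  also have "\<bar>\<dots>\<bar> \<le> \<bar>(\<theta> * um)\<^sup>2 / 2 * ((\<rho> r0 - \<rho>E r0) * (\<rho> r0 + \<rho>E r0))\<bar>
      + \<bar>(\<rho> r)\<^sup>2 * bernoulli_defect \<rho> u r\<bar>"
    by (rule abs_triangle_ineq4)
  also have "\<dots> \<le> 1 / 2 * (t / c * (3 * rp)) + (3 / 2 * rp)\<^sup>2 * t"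
  proof (rule add_mono)
    have "\<bar>(\<theta> * um)\<^sup>2 / 2\<bar> * (\<bar>\<rho> r0 - \<rho>E r0\<bar> * \<bar>\<rho> r0 + \<rho>E r0\<bar>) \<le> 1 / 2 * (t / c * (3 * rp))"
      using \<theta>um d0 bds abs_le_square_iff[of "\<theta> * um" 1] t_nonneg c
      by (intro mult_mono) auto
    then show "\<bar>(\<theta> * um)\<^sup>2 / 2 * ((\<rho> r0 - \<rho>E r0) * (\<rho> r0 + \<rho>E r0))\<bar> \<le> 1 / 2 * (t / c * (3 * rp))"
      by (simp only: abs_mult)
    have "(\<rho> r)\<^sup>2 * \<bar>bernoulli_defect \<rho> u r\<bar> \<le> (3 / 2 * rp)\<^sup>2 * t"
      using bds defect[OF r] by (intro mult_mono power_mono) (auto simp: t_def)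
    then show "\<bar>(\<rho> r)\<^sup>2 * bernoulli_defect \<rho> u r\<bar> \<le> (3 / 2 * rp)\<^sup>2 * t"
      by (simp only: abs_mult abs_power2)
  qed
  finally have "c * \<bar>\<rho> r - \<rho>E r\<bar> \<le> 1 / 2 * (t / c * (3 * rp)) + (3 / 2 * rp)\<^sup>2 * t"
    using flux_fun_expansive[OF near[OF r] nearE[OF r]] by linarith
  also have "\<dots> = c * (density_const B * \<mu>)"
    using c by (simp add: density_const_def t_def field_simps power2_eq_square)
  finally show d: "\<bar>\<rho> r - \<rho>E r\<bar> \<le> density_const B * \<mu>"
    using c by simp
  \<comment> \<open>The difference of the two quotients is split into the density error at
    \<open>r0\<close> and the one at \<open>r\<close>.\<close>
  have "u r - uE r = \<theta> * um * (((\<rho> r0 - \<rho>E r0) * \<rho>E r + \<rho>E r0 * (\<rho>E r - \<rho> r)) / (\<rho> r * \<rho>E r))"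
  proof -
    have "u r = \<theta> * um * \<rho> r0 / \<rho> r" "uE r = \<theta> * um * \<rho>E r0 / \<rho>E r"
      using flux fluxE bds by (simp_all add: field_simps)
    then show ?thesis
      using bds by (simp add: field_simps)
  qed
  then have "\<bar>u r - uE r\<bar> = \<bar>\<theta> * um\<bar> * (\<bar>(\<rho> r0 - \<rho>E r0) * \<rho>E r + \<rho>E r0 * (\<rho>E r - \<rho> r)\<bar> / (\<rho> r * \<rho>E r))"
    using bds by (simp add: abs_mult)
  also have "\<dots> \<le> 1 * ((3 / 2 * rp) * (t / c + density_const B * \<mu>) / (rp / 2 * (rp / 2)))"
  proof (intro mult_mono frac_le)
    have "\<bar>(\<rho> r0 - \<rho>E r0) * \<rho>E r + \<rho>E r0 * (\<rho>E r - \<rho> r)\<bar>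
        \<le> \<bar>\<rho> r0 - \<rho>E r0\<bar> * \<bar>\<rho>E r\<bar> + \<bar>\<rho>E r0\<bar> * \<bar>\<rho> r - \<rho>E r\<bar>"
      using abs_triangle_ineq[of "(\<rho> r0 - \<rho>E r0) * \<rho>E r" "\<rho>E r0 * (\<rho>E r - \<rho> r)"]
      by (simp add: abs_mult abs_minus_commute)
    also have "\<dots> \<le> t / c * (3 / 2 * rp) + (3 / 2 * rp) * (density_const B * \<mu>)"
      using bds d0 d rp t_nonneg c by (intro add_mono mult_mono) auto
    finally show "\<bar>(\<rho> r0 - \<rho>E r0) * \<rho>E r + \<rho>E r0 * (\<rho>E r - \<rho> r)\<bar>
        \<le> 3 / 2 * rp * (t / c + density_const B * \<mu>)"
      by (simp add: algebra_simps)
    have "0 \<le> density_const B * \<mu>"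
      using d by linarith
    then show "0 \<le> 3 / 2 * rp * (t / c + density_const B * \<mu>)"
      using rp t_nonneg c by simp
  qed (use \<theta>um bds rp in auto)
  also have "\<dots> = velocity_const B * \<mu>"
    by (simp add: velocity_const_def t_def power2_eq_square algebra_simps add_divide_distrib)
  finally show "\<bar>u r - uE r\<bar> \<le> velocity_const B * \<mu>" .
qed

text \<open>The first two smallness conditions trap the Euler density; the last two make the viscous
  flow subsonic and keep its density within \<delta> of \<open>rp\<close>.\<close>

lemma inviscid_limit:
  assumes euler: "euler_solution (Suc q) r0 p rp um \<rho>E uE"
    and small: "rp\<^sup>2 * um\<^sup>2 < c * \<delta>" "um\<^sup>2 / 2 < c * \<delta>" "\<bar>um\<bar> \<le> 1"
      "K\<^sup>2 * um\<^sup>2 \<le> c / 2 * (r0 ^ q)\<^sup>2" "K * um\<^sup>2 \<le> \<delta> * (r0 ^ q)\<^sup>2"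
    and um: "um \<le> 0" and K: "K > 0" and \<mu>: "\<mu> > 0"
    and ns: "decaying_navier_stokes_solution (Suc q) r0 p rp K um \<mu> \<rho> u" and r: "r \<ge> r0"
  shows "norm (\<rho> r - \<rho>E r, u r - uE r)
    \<le> (density_const (defect_const K) + velocity_const (defect_const K)) * \<mu>"
proof (cases "um = 0")
  case True
  \<comment> \<open>Without inflow or outflow one cannot divide by the velocity, but the decay
    estimates force both flows to be the constant state.\<close>
  have "\<rho> r = rp" "u r = 0"
    using ns r True by (auto simp: decaying_navier_stokes_solution_def decay_estimates_def)
  moreover have "\<rho>E r = rp" "uE r = 0"
    using euler_decay[OF euler r small(1,2)] True by auto
  moreover have "0 \<le> density_const (defect_const K) + velocity_const (defect_const K)"
    using rp c K r0 by (simp add: density_const_def velocity_const_def defect_const_def)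
  ultimately show ?thesis
    using \<mu> by simp
next
  case False
  have sol: "navier_stokes_solution (Suc q) r0 p rp um \<mu> \<rho> u"
    and decay: "decay_estimates (Suc q) r0 rp um K \<rho> u"
    using ns by (auto simp: decaying_navier_stokes_solution_def)
  have near: "\<rho> s \<in> {rp - \<delta>..rp + \<delta>}" if s: "s \<ge> r0" for s
  proof -
    have "\<bar>\<rho> s - rp\<bar> \<le> K * um\<^sup>2 / (s ^ q)\<^sup>2"
      using decay s by (auto simp: decay_estimates_def divide_inverse mult_ac simp flip: power_mult)
    also have "\<dots> \<le> K * um\<^sup>2 / (r0 ^ q)\<^sup>2"
      using s r0 K by (intro divide_left_mono power_mono mult_pos_pos) auto
    also have "\<dots> \<le> \<delta>"
      using small(5) r0 by (simp add: pos_divide_le_eq)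
    finally show ?thesis
      by auto
  qed
  have sm: "smooth_on {r0..} \<rho>" "smooth_on {r0..} u"
    and eq: "\<And>r. r > r0 \<Longrightarrow> deriv (\<lambda>s. s ^ q * \<rho> s * u s) r = 0" and u0: "u r0 = um"
    using sol by (auto simp: navier_stokes_solution_def far_field_and_boundary_def)
  have um_neg: "um < 0"
    using um False by simp
  note stab = euler_stability[OF euler small(1-3) mass_conservation[OF sm eq] u0 near
      bernoulli_defect_bound[OF sol decay \<mu> K um_neg small(3,4) near] r]
  have "norm (\<rho> r - \<rho>E r, u r - uE r) \<le> \<bar>\<rho> r - \<rho>E r\<bar> + \<bar>u r - uE r\<bar>"
    using norm_Pair_le[of "\<rho> r - \<rho>E r" "u r - uE r"] by simp
  then show ?thesis
    using stab by (simp add: distrib_right)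
qed

end

section \<open>Construction of the enthalpy and of the neighbourhood of \<open>rp\<close>\<close>

lemma enthalpy_exists:
  assumes "smooth_on {0<..} f"
  obtains h where "smooth_on {0<..} h" "\<And>x. x > 0 \<Longrightarrow> (h has_real_derivative f x / x) (at x)"
proof -
  have "isCont (\<lambda>x. f x / x) x" if "x > 0" for x
    using smooth_on_continuous_on[OF assms] that
    by (intro continuous_intros) (auto simp: continuous_on_eq_continuous_at)
  then obtain h where "\<And>x :: real. 0 < ereal x \<Longrightarrow> ereal x < \<infinity> \<Longrightarrow> (h has_vector_derivative f x / x) (at x)"
    using einterval_antiderivative[of 0 \<infinity> "\<lambda>x. f x / x"] by auto
  then have h: "(h has_real_derivative f x / x) (at x)" if "x > 0" for x
    using that by (simp add: has_real_derivative_iff_has_vector_derivative)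
  have "times_differentiable_on k {0<..} (\<lambda>x. f x / x)" for k
    unfolding divide_inverse
    by (intro times_differentiable_on_mult times_differentiable_on_inverse times_differentiable_on_ident
        smooth_on_imp_times_differentiable_on[OF assms]) auto
  then have "times_differentiable_on (Suc k) {0<..} h" for k
    unfolding times_differentiable_on.simps
    using h by (intro exI[of _ "\<lambda>x. f x / x"]) (auto intro: has_field_derivative_at_within)
  then have "smooth_on {0<..} h"
    by (rule times_differentiable_on_imp_smooth_on[OF times_differentiable_on_Suc_D])
      (auto simp: at_within_open[OF _ open_greaterThan])
  then show ?thesis
    using h that by blast
qed

lemma positive_near:
  fixes f :: "real \<Rightarrow> real"
  assumes "isCont f a" "f a > 0"
  shows "\<forall>\<^sub>F x in nhds a. f a / 2 < f x"
  using assms by (intro order_tendstoD) (auto simp: isCont_def tendsto_at_iff_tendsto_nhds)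

text \<open>The three quantities to be bounded below are positive at \<open>rp\<close>, the third
  because its subtracted term vanishes there; by continuity each stays above half its value
  nearby.\<close>

lemma barotropic_flow_exists:
  assumes "q \<ge> 1" "r0 > 0" "rp > 0" and p: "smooth_on {0<..} p" "\<And>x. x > 0 \<Longrightarrow> deriv p x > 0"
  obtains p' h \<delta> c where "barotropic_flow q r0 rp p p' h \<delta> c"
proof -
  obtain p' where p'_smooth: "smooth_on {0<..} p'"
    and p'_within: "\<And>x. x \<in> {0<..} \<Longrightarrow> (p has_real_derivative p' x) (at x within {0<..})"
    using smooth_on_imp_smooth_derivative[OF p(1)] by metis
  have p': "(p has_real_derivative p' x) (at x)" if "x > 0" for x
    using p'_within[of x] that at_within_open[of x "{0<..}"] by simp
  have p'_pos: "p' x > 0" if "x > 0" for x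
    using p(2)[OF that] DERIV_imp_deriv[OF p'[OF that]] by simp
  obtain h where h: "smooth_on {0<..} h" "\<And>x. x > 0 \<Longrightarrow> (h has_real_derivative p' x / x) (at x)"
    using enthalpy_exists[OF p'_smooth] by metis
  have cont: "isCont p' rp" "isCont h rp"
    using smooth_on_continuous_on[OF p'_smooth] smooth_on_continuous_on[OF h(1)] \<open>rp > 0\<close>
    by (auto simp: continuous_on_eq_continuous_at)
  define f where "f x = x * p' x - 2 * x * (h rp - h x)" for x
  have pos: "p' rp > 0" "p' rp / rp > 0" "f rp > 0"
    using p'_pos \<open>rp > 0\<close> by (auto simp: f_def)
  define c where "c = Min {p' rp / 2, p' rp / rp / 2, f rp / 2}"
  have c: "c > 0" "c \<le> p' rp / 2" "c \<le> p' rp / rp / 2" "c \<le> f rp / 2"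
    using pos by (auto simp: c_def)
  have "\<forall>\<^sub>F x in nhds rp. p' rp / 2 < p' x \<and> p' rp / rp / 2 < p' x / x \<and> f rp / 2 < f x"
  proof (intro eventually_conj positive_near pos cont)
    show "isCont (\<lambda>x. p' x / x) rp"
      using cont \<open>rp > 0\<close> by (intro continuous_intros) auto
    show "isCont f rp"
      unfolding f_def[abs_def] using cont by (intro continuous_intros)
  qed
  then obtain d where d: "d > 0"
    "\<And>x. dist x rp < d \<Longrightarrow> p' rp / 2 < p' x \<and> p' rp / rp / 2 < p' x / x \<and> f rp / 2 < f x"
    unfolding eventually_nhds_metric by blast
  \<comment> \<open>Halving \<open>d\<close> fits the closed interval into the open ball; the cap
    \<open>rp / 2\<close> keeps it away from vacuum.\<close>
  define \<delta> where "\<delta> = min (d / 2) (rp / 2)"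
  have \<delta>: "0 < \<delta>" "\<delta> \<le> rp / 2" "\<delta> < d"
    using d(1) \<open>rp > 0\<close> by (auto simp: \<delta>_def)
  have near: "c \<le> p' x" "c \<le> p' x / x" "c \<le> f x" if "x \<in> {rp - \<delta>..rp + \<delta>}" for x
  proof -
    have "dist x rp < d"
      using that \<delta> by (auto simp: dist_real_def)
    then show "c \<le> p' x" "c \<le> p' x / x" "c \<le> f x"
      using d(2)[of x] c by linarith+
  qed
  have "barotropic_flow q r0 rp p p' h \<delta> c"
    by (rule barotropic_flow.intro)
      (fact assms p' p'_pos h \<delta> c near(1,2) near(3)[unfolded f_def])+
  then show ?thesis
    using that by blast
qed

text \<open>\<open>K\<close> stands for the uniform decay constant of the known viscous solutions
  and is fixed before \<open>\<epsilon>0\<close> and \<open>C\<close>. The supremum is taken in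
  \<open>ereal\<close>, where it is meaningful without a prior boundedness proof.\<close>

theorem theorem1p2:
  fixes n :: nat and r0 rp K :: real and p :: "real \<Rightarrow> real"
  assumes "n \<ge> 2" and "r0 > 0"
    and "smooth_on {0<..} p" and "\<And>x. x > 0 \<Longrightarrow> deriv p x > 0"
    and "rp > 0" and "K > 0"
  shows "\<exists>\<epsilon>0>0. \<exists>C>0. \<forall>um. um \<le> 0 \<and> \<bar>um\<bar> \<le> \<epsilon>0 \<longrightarrow>
    (\<exists>\<rho>E uE.
       euler_solution n r0 p rp um \<rho>E uE \<and>
       (\<forall>\<rho> u. euler_solution n r0 p rp um \<rho> u \<longrightarrow> (\<forall>r\<ge>r0. \<rho> r = \<rho>E r \<and> u r = uE r)) \<and>
       decay_estimates n r0 rp um C \<rho>E uE \<and>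
       (\<forall>\<mu> \<rho> u. 0 < \<mu> \<and> \<mu> \<le> 1 \<and> decaying_navier_stokes_solution n r0 p rp K um \<mu> \<rho> u \<longrightarrow>
          (SUP r\<in>{r0..}. ereal (norm (\<rho> r - \<rho>E r, u r - uE r))) \<le> ereal (C * \<mu>)) \<and>
       (\<forall>\<rho> u. (\<forall>\<mu>. 0 < \<mu> \<and> \<mu> \<le> 1 \<longrightarrow>
                 decaying_navier_stokes_solution n r0 p rp K um \<mu> (\<rho> \<mu>) (u \<mu>)) \<longrightarrow>
          uniform_limit {r0..} (\<lambda>\<mu> r. (\<rho> \<mu> r, u \<mu> r)) (\<lambda>r. (\<rho>E r, uE r)) (at_right 0)))"
proof -
  obtain q where n: "n = Suc q" and q: "q \<ge> 1"
    using assms(1) by (cases n) auto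
  obtain p' h \<delta> c where flow: "barotropic_flow q r0 rp p p' h \<delta> c"
    using barotropic_flow_exists[OF q assms(2,5,3,4)] by blast
  interpret barotropic_flow q r0 rp p p' h \<delta> c
    by (rule flow)
  define R where "R = r0 ^ q"
  have R: "R > 0"
    using r0 by (simp add: R_def)
  \<comment> \<open>\<open>A\<close> dominates every coefficient of \<open>um\<^sup>2\<close> in the
    smallness conditions, and \<open>\<sigma>\<close> is the least threshold, with
    \<open>c * \<delta>\<close> halved to obtain strict inequalities.\<close>
  define A where "A = rp\<^sup>2 + 1 + K\<^sup>2 + K"
  define \<sigma> where "\<sigma> = Min {c * \<delta> / 2, c / 2 * R\<^sup>2, \<delta> * R\<^sup>2}"
  have A: "A > 0" "rp\<^sup>2 \<le> A" "1 / 2 \<le> A" "K\<^sup>2 \<le> A" "K \<le> A"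
    using assms(6) rp by (auto simp: A_def add_pos_nonneg intro: add_increasing)
  have \<sigma>: "\<sigma> > 0" "\<sigma> < c * \<delta>" "\<sigma> \<le> c / 2 * R\<^sup>2" "\<sigma> \<le> \<delta> * R\<^sup>2"
    using c \<delta> R by (auto simp: \<sigma>_def min_less_iff_disj)
  \<comment> \<open>The cap \<open>1\<close> gives \<open>um\<^sup>2 \<le> \<bar>um\<bar>\<close>,
    so a bound on \<open>\<bar>um\<bar>\<close> suffices.\<close>
  define \<epsilon>0 where "\<epsilon>0 = min 1 (\<sigma> / A)"
  have \<epsilon>0: "\<epsilon>0 > 0"
    using A \<sigma> by (simp add: \<epsilon>0_def)
  define Cv where "Cv = density_const (defect_const K) + velocity_const (defect_const K)"
  have Cv: "Cv \<ge> 0"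
    using rp c assms(6) r0 by (simp add: Cv_def density_const_def velocity_const_def defect_const_def)
  \<comment> \<open>Each summand dominates one required constant; \<open>2 / R\<close> is there
    because the lower velocity bound needs \<open>inverse C \<le> R / 2\<close>.\<close>
  define C where "C = 2 * R + 2 / R + (2 * R)\<^sup>2 / (2 * c) + Cv"
  have C: "2 * R \<le> C" "2 / R \<le> C" "(2 * R)\<^sup>2 / (2 * c) \<le> C" "Cv \<le> C" "C > 0"
    using R c Cv by (auto simp: C_def intro!: add_increasing add_increasing2 add_pos_nonneg)
  have "inverse C \<le> inverse (2 / R)"
    using C R by (intro le_imp_inverse_le) auto
  then have C_inv: "inverse C \<le> R / 2"
    by simp
  have main: "\<exists>\<rho>E uE.
       euler_solution n r0 p rp um \<rho>E uE \<and>
       (\<forall>\<rho> u. euler_solution n r0 p rp um \<rho> u \<longrightarrow> (\<forall>r\<ge>r0. \<rho> r = \<rho>E r \<and> u r = uE r)) \<and>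
       decay_estimates n r0 rp um C \<rho>E uE \<and>
       (\<forall>\<mu> \<rho> u. 0 < \<mu> \<and> \<mu> \<le> 1 \<and> decaying_navier_stokes_solution n r0 p rp K um \<mu> \<rho> u \<longrightarrow>
          (SUP r\<in>{r0..}. ereal (norm (\<rho> r - \<rho>E r, u r - uE r))) \<le> ereal (C * \<mu>)) \<and>
       (\<forall>\<rho> u. (\<forall>\<mu>. 0 < \<mu> \<and> \<mu> \<le> 1 \<longrightarrow>
                 decaying_navier_stokes_solution n r0 p rp K um \<mu> (\<rho> \<mu>) (u \<mu>)) \<longrightarrow>
          uniform_limit {r0..} (\<lambda>\<mu> r. (\<rho> \<mu> r, u \<mu> r)) (\<lambda>r. (\<rho>E r, uE r)) (at_right 0))"
    if um: "um \<le> 0" "\<bar>um\<bar> \<le> \<epsilon>0" for um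
  proof -
    have um1: "\<bar>um\<bar> \<le> 1" and "\<bar>um\<bar> \<le> \<sigma> / A"
      using um(2) by (auto simp: \<epsilon>0_def)
    moreover have "um\<^sup>2 \<le> \<bar>um\<bar>"
      using um1 mult_left_le_one_le[of "\<bar>um\<bar>" "\<bar>um\<bar>"] by (simp add: power2_eq_square)
    ultimately have "um\<^sup>2 \<le> \<sigma> / A"
      by linarith
    then have Aum: "A * um\<^sup>2 \<le> \<sigma>"
      using A by (simp add: field_simps)
    have scale: "a * um\<^sup>2 \<le> \<sigma>" if "a \<le> A" for a
      using mult_right_mono[OF that, of "um\<^sup>2"] Aum by simp
    have small: "rp\<^sup>2 * um\<^sup>2 < c * \<delta>" "um\<^sup>2 / 2 < c * \<delta>"
      "K\<^sup>2 * um\<^sup>2 \<le> c / 2 * (r0 ^ q)\<^sup>2" "K * um\<^sup>2 \<le> \<delta> * (r0 ^ q)\<^sup>2"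
      using scale[OF A(2)] scale[OF A(3)] scale[OF A(4)] scale[OF A(5)] \<sigma> by (auto simp: R_def)
    obtain \<rho>E uE where E: "euler_solution (Suc q) r0 p rp um \<rho>E uE"
      using euler_exists[OF small(1,2)] by blast
    have conv: "norm (\<rho> r - \<rho>E r, u r - uE r) \<le> C * \<mu>"
      if "\<mu> > 0" "decaying_navier_stokes_solution n r0 p rp K um \<mu> \<rho> u" "r \<ge> r0" for \<mu> \<rho> u r
    proof -
      have "norm (\<rho> r - \<rho>E r, u r - uE r) \<le> Cv * \<mu>"
        unfolding Cv_def
        by (rule inviscid_limit[OF E small(1,2) um1 small(3,4) um(1) assms(6) that(1)])
          (use that n in auto)
      also have "\<dots> \<le> C * \<mu>"
        using C that by (intro mult_right_mono) auto
      finally show ?thesis .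
    qed
    show ?thesis
    proof (rule exI[of _ \<rho>E], rule exI[of _ uE], intro conjI allI impI)
      show "euler_solution n r0 p rp um \<rho>E uE"
        using E n by simp
      show "\<rho> r = \<rho>E r" "u r = uE r"
        if "euler_solution n r0 p rp um \<rho> u" "r0 \<le> r" for \<rho> u r
        using euler_unique[OF _ E that(2) small(1,2)] that(1) n by auto
      show "decay_estimates n r0 rp um C \<rho>E uE"
        unfolding decay_estimates_def
      proof (intro allI impI conjI)
        fix r assume r: "r0 \<le> r"
        have r_pos: "r > 0"
          using r r0 by simp
        note D = euler_decay[OF E r small(1,2), folded R_def]
        show "\<bar>\<rho>E r - rp\<bar> \<le> C * inverse (r ^ (2 * (n - 1))) * \<bar>um\<bar>\<^sup>2"
          using D(1) mult_right_mono[OF C(3), of "inverse (r ^ (2 * q)) * \<bar>um\<bar>\<^sup>2"] n r_pos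
          by (simp add: mult.assoc)
        show "inverse C * inverse (r ^ (n - 1)) * \<bar>um\<bar> \<le> \<bar>uE r\<bar>"
          using order_trans[OF mult_right_mono[OF C_inv, of "inverse (r ^ q) * \<bar>um\<bar>"]] D(2) n r_pos
          by (simp add: mult.assoc)
        show "\<bar>uE r\<bar> \<le> C * inverse (r ^ (n - 1)) * \<bar>um\<bar>"
          using order_trans[OF _ mult_right_mono[OF C(1), of "inverse (r ^ q) * \<bar>um\<bar>"]] D(3) n r_pos
          by (simp add: mult.assoc)
      qed
      show "(SUP r\<in>{r0..}. ereal (norm (\<rho> r - \<rho>E r, u r - uE r))) \<le> ereal (C * \<mu>)"
        if "0 < \<mu> \<and> \<mu> \<le> 1 \<and> decaying_navier_stokes_solution n r0 p rp K um \<mu> \<rho> u" for \<mu> \<rho> u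
        using conv that by (intro SUP_least) auto
      show "uniform_limit {r0..} (\<lambda>\<mu> r. (\<rho> \<mu> r, u \<mu> r)) (\<lambda>r. (\<rho>E r, uE r)) (at_right 0)"
        if ns: "\<forall>\<mu>. 0 < \<mu> \<and> \<mu> \<le> 1 \<longrightarrow>
          decaying_navier_stokes_solution n r0 p rp K um \<mu> (\<rho> \<mu>) (u \<mu>)" for \<rho> u
      proof (rule uniform_limitI)
        fix e :: real assume e: "e > 0"
        have "\<forall>\<^sub>F \<mu> in at_right 0. \<mu> \<in> {0<..<min 1 (e / C)}"
          using e C by (intro eventually_at_right_real) auto
        then show "\<forall>\<^sub>F \<mu> in at_right 0. \<forall>r\<in>{r0..}. dist (\<rho> \<mu> r, u \<mu> r) (\<rho>E r, uE r) < e"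
        proof eventually_elim
          case (elim \<mu>)
          then have \<mu>: "0 < \<mu>" "\<mu> \<le> 1" "C * \<mu> < e"
            using C by (auto simp: field_simps)
          then show ?case
            using conv[OF \<mu>(1)] ns by (fastforce simp: dist_norm)
        qed
      qed
    qed
  qed
  show ?thesis
    by (rule exI[of _ \<epsilon>0], rule conjI[OF \<epsilon>0], rule exI[of _ C], rule conjI[OF C(5)]) (use main in blast)
qed

end
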